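(* Let $p_0=1$, $p_1=p_2\in(1/2,1)$, and $p_3=0$. Let $\mu_B^N$ (resp., $\mu_{[r,s]}^N$) denote the mean profit per turn to the ensemble of $N\ge3$ players always playing game $B$ (resp., repeatedly playing the nonrandom pattern $A^rB^s$, where $r,s\ge1$). Then $\mu_B^N=0$ for all even $N\ge4$, $\mu_B^N>0$ for all odd $N\ge3$, and $\mu_{[r,1]}^N>0$ for all $N\ge3$ and $r\ge1$. In particular, when $s=1$, for every $r\ge1$ and $N\ge3$ the Parrondo effect for the pattern $A^rB^s$ (that is, $\mu_B^N\le0$ and $\mu_{[r,s]}^N>0$) is present if and only if $N$ is even.
   Context: Let $N\ge3$, $p_0,p_1,p_2,p_3\in[0,1]$, $q_m:=1-p_m$, and $\Sigma:=\{0,1\}^N$. For $\mathbf x=(x_1,\ldots,x_N)\in\Sigma$, $x_i=1$ (resp. $0$) means player $i$ is a winner (resp. loser) of his most recent game; indices are circular: $x_0:=x_N$, $x_{N+1}:=x_1$. Let $m_i(\mathbf x):=2x_{i-1}+x_{i+1}\in\{0,1,2,3\}$, and let $\mathbf x^i$ be $\mathbf x$ with its $i$th component flipped. At each turn a uniformly random player $i$ plays. In game $B$ he tosses a coin with probability of heads $p_{m_i(\mathbf x)}$; in game $A$ he tosses a fair coin. With heads he wins one unit and becomes a winner; with tails he loses one unit and becomes a loser. Formally, on $\Sigma^*:=\Sigma\times\{1,\ldots,N\}$, where the state $(\mathbf x,i)$ means that $\mathbf x$ is the status vector and $i$ is the next player to play, define the transition matrix $\mathbf P_B^*$ by, for all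 $(\mathbf x,i)\in\Sigma^*$ and $j\in\{1,\ldots,N\}$: $P_B^*((\mathbf x,i),(\mathbf x^i,j)):=N^{-1}p_{m_i(\mathbf x)}$ if $x_i=0$ and $N^{-1}q_{m_i(\mathbf x)}$ if $x_i=1$; $P_B^*((\mathbf x,i),(\mathbf x,j)):=N^{-1}q_{m_i(\mathbf x)}$ if $x_i=0$ and $N^{-1}p_{m_i(\mathbf x)}$ if $x_i=1$; all other entries are $0$. Let $\mathbf P_A^*$ be $\mathbf P_B^*$ with $p_0=p_1=p_2=p_3=1/2$. The payoff function $w$ equals $1$ for a win and $-1$ for a loss: $w((\mathbf x,i),(\mathbf x^i,j)):=1$ if $x_i=0$ and $-1$ if $x_i=1$; $w((\mathbf x,i),(\mathbf x,j)):=-1$ if $x_i=0$ and $1$ if $x_i=1$. For a chain $\{Y_n\}_{n\ge0}$ in $\Sigma^*$ with arbitrary initial distribution put $S_n:=\sum_{k=1}^n w(Y_{k-1},Y_k)$. The mean profit per turn is the nonrandom almost sure limit of $n^{-1}S_n$ as $n\to\infty$ (not depending on the initial distribution): it is denoted $\mu_B^N$ when every transition uses $\mathbf P_B^*$, and $\mu_{[r,s]}^N$ when the successive transition matrices are $\mathbf P_A^*$ ($r$ times), $\mathbf P_B^*$ ($s$ times), $\mathbf P_A^*$ ($r$ times), $\mathbf P_B^*$ ($s$ times), and so on. *)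

theory Defs
  imports "HOL-Probability.Probability"
begin

type_synonym status = "nat \<Rightarrow> nat"
type_synonym state = "status \<times> nat"

definition statuses :: "nat \<Rightarrow> status set" where
  "statuses N = {1..N} \<rightarrow>\<^sub>E {0, 1}"

definition states :: "nat \<Rightarrow> state set" where
  "states N = statuses N \<times> {1..N}"

definition left_of :: "nat \<Rightarrow> nat \<Rightarrow> nat" where
  "left_of N i = (if i = 1 then N else i - 1)"

definition right_of :: "nat \<Rightarrow> nat \<Rightarrow> nat" where
  "right_of N i = (if i = N then 1 else i + 1)"

definition nbrs :: "nat \<Rightarrow> status \<Rightarrow> nat \<Rightarrow> nat" where
  "nbrs N x i = 2 * x (left_of N i) + x (right_of N i)"

definition flip :: "status \<Rightarrow> nat \<Rightarrow> status" where
  "flip x i = x(i := 1 - x i)"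

text \<open>
  A transition matrix on \<open>states N\<close> is a function \<^typ>\<open>state \<Rightarrow> state \<Rightarrow> real\<close>; only its
  entries on \<open>states N\<close> are meaningful. In the following definition, \<open>p m\<close> is the probability
  of heads when the neighbours of the player are in configuration \<open>m \<in> {0, 1, 2, 3}\<close>.
\<close>

definition game :: "nat \<Rightarrow> (nat \<Rightarrow> real) \<Rightarrow> state \<Rightarrow> state \<Rightarrow> real" where
  "game N p = (\<lambda>(x, i) (y, j).
     if y = flip x i then
       (if x i = 0 then p (nbrs N x i) else 1 - p (nbrs N x i)) / real N
     else if y = x then
       (if x i = 0 then 1 - p (nbrs N x i) else p (nbrs N x i)) / real N
     else 0)"

definition game_A :: "nat \<Rightarrow> state \<Rightarrow> state \<Rightarrow> real" where
  "game_A N = game N (\<lambda>_. 1 / 2)"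

abbreviation game_B :: "nat \<Rightarrow> (nat \<Rightarrow> real) \<Rightarrow> state \<Rightarrow> state \<Rightarrow> real" where
  "game_B \<equiv> game"

text \<open>The final value 0 is a dummy: such transitions have probability 0.\<close>

definition payoff :: "state \<Rightarrow> state \<Rightarrow> real" where
  "payoff = (\<lambda>(x, i) (y, j).
     if y = flip x i then (if x i = 0 then 1 else - 1)
     else if y = x then (if x i = 0 then - 1 else 1)
     else 0)"

text \<open>
  A time-inhomogeneous Markov chain with state space \<open>S\<close> and arbitrary initial distribution;
  \<open>P n\<close> governs the transition from time \<open>n\<close> to time \<open>n + 1\<close>.
\<close>

definition markov_chain ::
  "'w measure \<Rightarrow> 's set \<Rightarrow> (nat \<Rightarrow> 's \<Rightarrow> 's \<Rightarrow> real) \<Rightarrow> (nat \<Rightarrow> 'w \<Rightarrow> 's) \<Rightarrow> bool" where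
  "markov_chain M S P Y \<longleftrightarrow>
     prob_space M \<and>
     (\<forall>n. Y n \<in> measurable M (count_space S)) \<and>
     (\<forall>n y z. (\<forall>k\<le>n. y k \<in> S) \<longrightarrow> z \<in> S \<longrightarrow>
        \<P>(\<omega> in M. \<forall>k\<le>n. Y k \<omega> = y k) > 0 \<longrightarrow>
        \<P>(\<omega> in M. Y (Suc n) \<omega> = z \<bar> \<forall>k\<le>n. Y k \<omega> = y k) = P n (y n) z)"

definition total_profit :: "(nat \<Rightarrow> 'w \<Rightarrow> state) \<Rightarrow> nat \<Rightarrow> 'w \<Rightarrow> real" where
  "total_profit Y n \<omega> = (\<Sum>k=1..n. payoff (Y (k - 1) \<omega>) (Y k \<omega>))"

text \<open>
  The chain is required to live on a probability space over the type of paths. This is no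
  restriction: the convergence statement depends only on the law of the chain, and every law
  is realized on the path space.
\<close>

definition is_mean_profit :: "nat \<Rightarrow> (nat \<Rightarrow> state \<Rightarrow> state \<Rightarrow> real) \<Rightarrow> real \<Rightarrow> bool" where
  "is_mean_profit N P \<mu> \<longleftrightarrow>
     (\<forall>(M :: (nat \<Rightarrow> state) measure) Y. markov_chain M (states N) P Y \<longrightarrow>
        (AE \<omega> in M. (\<lambda>n. total_profit Y n \<omega> / real n) \<longlonglongrightarrow> \<mu>))"

definition mean_profit :: "nat \<Rightarrow> (nat \<Rightarrow> state \<Rightarrow> state \<Rightarrow> real) \<Rightarrow> real" where
  "mean_profit N P = (THE \<mu>. is_mean_profit N P \<mu>)"

definition mu_B :: "nat \<Rightarrow> (nat \<Rightarrow> real) \<Rightarrow> real" where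
  "mu_B N p = mean_profit N (\<lambda>_. game_B N p)"

definition mu_pattern :: "nat \<Rightarrow> (nat \<Rightarrow> real) \<Rightarrow> nat \<Rightarrow> nat \<Rightarrow> real" where
  "mu_pattern N p r s =
     mean_profit N (\<lambda>n. if n mod (r + s) < r then game_A N else game_B N p)"

definition parrondo_effect :: "nat \<Rightarrow> (nat \<Rightarrow> real) \<Rightarrow> nat \<Rightarrow> nat \<Rightarrow> bool" where
  "parrondo_effect N p r s \<longleftrightarrow> mu_B N p \<le> 0 \<and> mu_pattern N p r s > 0"

end

theory Submission
  imports Defs "HOL-Library.Discrete_Functions" "Jordan_Normal_Form.Determinant"
begin

text \<open>
  The pair (status vector, position in the pattern) evolves by a finite walk, and the mean profit
  \<open>\<mu>\<close> is read off from a solution of the Poisson equation \<open>G + \<mu> = f + avg G\<close>, where \<open>f\<close> is the expected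
  payoff of a turn: the profit then differs from \<open>n * \<mu>\<close> by a bounded term and a martingale with
  bounded increments. No stationary distribution is needed: solvability and the sign of \<open>\<mu>\<close> both come
  from the maximum principle.

  In a turn of game B the number of winners has a drift that involves, besides the number of winners
  itself, only the number of players whose two neighbours differ in status. Adding a suitable multiple
  of the number of winners to \<open>G\<close> turns \<open>f\<close> into a nonnegative multiple of that number of players, whence
  \<open>\<mu> > 0\<close> as soon as it does not vanish on a closed set. Setting the status of a player opposite to
  that of his left neighbour has positive probability in both games, so sweeping once around the circle
  leads to an alternating configuration. For even \<open>N\<close> these are absorbing under game B and give zero
  profit; for odd \<open>N\<close>, or if game A is played too, no closed set avoids the discordant configurations.
\<close>

section \<open>Finite random walks and the Poisson equation\<close>

text \<open>An enumeration of \<open>Z\<close> turns \<open>A\<close> into a square matrix. A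
  trivial kernel makes its determinant nonzero, and the inverse matrix applied to \<open>f\<close>
  is the solution.\<close>

lemma finite_linear_system_solvable:
  fixes A :: "'a \<Rightarrow> 'a \<Rightarrow> real"
  assumes fin: "finite Z"
    and inj: "\<And>g. \<forall>z\<in>Z. (\<Sum>y\<in>Z. A z y * g y) = 0 \<Longrightarrow> \<forall>z\<in>Z. g z = 0"
  shows "\<exists>g. \<forall>z\<in>Z. (\<Sum>y\<in>Z. A z y * g y) = f z"
proof -
  define n where "n = card Z"
  obtain e where e: "bij_betw e {0..<n} Z"
    using ex_bij_betw_nat_finite[OF fin] unfolding n_def by blast
  define d where "d = inv_into {0..<n} e"
  have d: "d z < n" "e (d z) = z" if "z \<in> Z" for z
    using bij_betw_apply[OF bij_betw_inv_into[OF e] that] bij_betw_inv_into_right[OF e that]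
    by (simp_all add: d_def)
  have de: "d (e i) = i" if "i < n" for i
    using bij_betw_inv_into_left[OF e, of i] that by (simp add: d_def)
  define M where "M = mat n n (\<lambda>(i, j). A (e i) (e j))"
  have M: "M \<in> carrier_mat n n" by (simp add: M_def)
  have mult: "(M *\<^sub>v v) $ i = (\<Sum>y\<in>Z. A (e i) y * v $ d y)" if "i < n" "v \<in> carrier_vec n" for i v
  proof -
    have "(M *\<^sub>v v) $ i = (\<Sum>j\<in>{0..<n}. A (e i) (e j) * v $ j)"
      using that by (simp add: M_def scalar_prod_def)
    also have "\<dots> = (\<Sum>j\<in>{0..<n}. A (e i) (e j) * v $ d (e j))"
      by (intro sum.cong) (simp_all add: de)
    also have "\<dots> = (\<Sum>y\<in>Z. A (e i) y * v $ d y)"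
      by (rule sum.reindex_bij_betw[OF e])
    finally show ?thesis .
  qed
  have "v = 0\<^sub>v n" if v: "v \<in> carrier_vec n" and "M *\<^sub>v v = 0\<^sub>v n" for v
  proof -
    have "\<forall>z\<in>Z. (\<Sum>y\<in>Z. A z y * v $ d y) = 0"
    proof
      fix z assume "z \<in> Z"
      then show "(\<Sum>y\<in>Z. A z y * v $ d y) = 0"
        using mult[OF d(1) v, of z] d that(2) by simp
    qed
    from inj[OF this] have "\<forall>z\<in>Z. v $ d z = 0" .
    then have "v $ i = 0" if i: "i < n" for i
      using bspec[OF \<open>\<forall>z\<in>Z. v $ d z = 0\<close>, of "e i"] bij_betw_apply[OF e, of i] i de by simp
    then show ?thesis using v by (intro eq_vecI) auto
  qed
  then have "det M \<noteq> 0"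
    using det_0_iff_vec_prod_zero_field[OF M] by blast
  from det_non_zero_imp_unit[OF M this, of "()"] obtain B
    where B: "B \<in> carrier_mat n n" "M * B = 1\<^sub>m n"
    unfolding Units_def ring_mat_simps by blast
  define v where "v = B *\<^sub>v vec n (\<lambda>i. f (e i))"
  have v: "v \<in> carrier_vec n" using B by (simp add: v_def)
  have "M *\<^sub>v v = vec n (\<lambda>i. f (e i))"
    unfolding v_def using B M
    by (subst assoc_mult_mat_vec[symmetric, OF M B(1)]) auto
  then have "(\<Sum>y\<in>Z. A z y * v $ d y) = f z" if "z \<in> Z" for z
    using mult[OF d(1) v, OF that] d that by simp
  then show ?thesis by (intro exI[of _ "\<lambda>y. v $ d y"]) simp
qed

section \<open>Maximum principle, Dirichlet problem and Poisson equation\<close>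

locale random_moves =
  fixes Z :: "'z set" and J :: "'j set" and K :: "'z \<Rightarrow> 'j \<Rightarrow> real" and step :: "'z \<Rightarrow> 'j \<Rightarrow> 'z"
  assumes finite_Z: "finite Z" and finite_J: "finite J"
    and K_nonneg: "\<And>z j. z \<in> Z \<Longrightarrow> j \<in> J \<Longrightarrow> 0 \<le> K z j"
    and K_sum: "\<And>z. z \<in> Z \<Longrightarrow> (\<Sum>j\<in>J. K z j) = 1"
    and step_in: "\<And>z j. z \<in> Z \<Longrightarrow> j \<in> J \<Longrightarrow> step z j \<in> Z"
begin

definition avg :: "('z \<Rightarrow> real) \<Rightarrow> 'z \<Rightarrow> real" where
  "avg G z = (\<Sum>j\<in>J. K z j * G (step z j))"

definition absorbing :: "'z set \<Rightarrow> bool" where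
  "absorbing C \<longleftrightarrow> C \<subseteq> Z \<and> C \<noteq> {} \<and> (\<forall>z\<in>C. \<forall>j\<in>J. K z j > 0 \<longrightarrow> step z j \<in> C)"

lemma avg_add: "avg (\<lambda>z. F z + G z) z = avg F z + avg G z"
  by (simp add: avg_def sum.distrib algebra_simps)

lemma avg_cmult: "avg (\<lambda>z. c * G z) z = c * avg G z"
  by (simp add: avg_def sum_distrib_left algebra_simps)

lemma avg_minus: "avg (\<lambda>z. - G z) z = - avg G z"
  using avg_cmult[of "-1"] by simp

lemma avg_diff: "avg (\<lambda>z. F z - G z) z = avg F z - avg G z"
  using avg_add[of F "\<lambda>z. - G z"] by (simp add: avg_minus)

text \<open>At a maximizer the maximum is at most an average of values that do not exceed it, so no
  move of positive probability can lead to a smaller value.\<close>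

lemma argmax_absorbing:
  fixes G :: "'z \<Rightarrow> real"
  defines "C \<equiv> {z \<in> Z. G z = Max (G ` Z)}"
  assumes "Z \<noteq> {}" and sub: "\<And>z. z \<in> C \<Longrightarrow> G z \<le> avg G z"
  shows "absorbing C"
proof -
  have "Max (G ` Z) \<in> G ` Z" using assms finite_Z by (intro Max_in) auto
  then have ne: "C \<noteq> {}" by (auto simp: C_def)
  have le: "G y \<le> Max (G ` Z)" if "y \<in> Z" for y using that finite_Z by auto
  have "step z j \<in> C" if z: "z \<in> C" and j: "j \<in> J" and pos: "K z j > 0" for z j
  proof (rule ccontr)
    have zZ: "z \<in> Z" using z by (simp add: C_def)
    assume "step z j \<notin> C"
    then have "G (step z j) < Max (G ` Z)"
      using le[OF step_in[OF zZ j]] step_in[OF zZ j] by (auto simp: C_def)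
    then have "avg G z < (\<Sum>i\<in>J. K z i * Max (G ` Z))"
      unfolding avg_def using finite_J j pos zZ
      by (intro sum_strict_mono_ex1) (auto intro!: mult_left_mono le step_in K_nonneg bexI[of _ j])
    also have "\<dots> = Max (G ` Z)"
      by (simp add: sum_distrib_right[symmetric] K_sum zZ)
    finally show False using sub[OF z] z by (simp add: C_def)
  qed
  then show ?thesis using ne by (auto simp: absorbing_def C_def)
qed

text \<open>If the maximum were positive, the maximizers would avoid \<open>D\<close>, where
  \<open>G \<le> 0\<close>. Then \<open>G\<close> would be subharmonic at all of them, and they
  would form an absorbing set that misses \<open>D\<close>.\<close>

lemma max_principle:
  assumes D: "\<And>C. absorbing C \<Longrightarrow> C \<inter> D \<noteq> {}"
    and sub: "\<And>z. z \<in> Z - D \<Longrightarrow> G z \<le> avg G z"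
    and bd: "\<And>z. z \<in> Z \<inter> D \<Longrightarrow> G z \<le> 0" and z: "z \<in> Z"
  shows "G z \<le> 0"
proof (rule ccontr)
  assume "\<not> G z \<le> 0"
  moreover have "G z \<le> Max (G ` Z)" using z finite_Z by auto
  ultimately have pos: "Max (G ` Z) > 0" by linarith
  let ?C = "{z \<in> Z. G z = Max (G ` Z)}"
  have dis: "?C \<inter> D = {}" using bd pos by force
  have "absorbing ?C"
  proof (rule argmax_absorbing)
    fix y assume "y \<in> ?C"
    with dis have "y \<in> Z - D" by blast
    then show "G y \<le> avg G y" by (rule sub)
  qed (use z in auto)
  with D dis show False by blast
qed

text \<open>The equations form a square linear system. A solution of the homogeneous system vanishes
  on \<open>D\<close> and is harmonic off \<open>D\<close>, so the maximum principle, applied to it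
  and to its negative, shows that it is zero.\<close>

lemma dirichlet_solvable:
  assumes D: "\<And>C. absorbing C \<Longrightarrow> C \<inter> D \<noteq> {}"
  shows "\<exists>G. (\<forall>z\<in>Z \<inter> D. G z = 0) \<and> (\<forall>z\<in>Z - D. G z = f z + avg G z)"
proof -
  \<comment> \<open>The matrix of \<open>G - avg G\<close> off \<open>D\<close> and of the identity
    on \<open>D\<close>. Moves with a common target are lumped into one entry.\<close>
  define A where "A z y = (if y = z then 1 else 0) -
    (if z \<in> D then 0 else \<Sum>j | j \<in> J \<and> step z j = y. K z j)" for z y
  have A: "(\<Sum>y\<in>Z. A z y * g y) = g z - (if z \<in> D then 0 else avg g z)" if z: "z \<in> Z" for z g
  proof -
    have "(\<Sum>y\<in>Z. (\<Sum>j | j \<in> J \<and> step z j = y. K z j) * g y)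
        = (\<Sum>y\<in>Z. \<Sum>j | j \<in> J \<and> step z j = y. K z j * g (step z j))"
      by (intro sum.cong refl) (auto simp: sum_distrib_right intro!: sum.cong)
    also have "\<dots> = avg g z"
      unfolding avg_def using finite_J finite_Z step_in[OF z]
      by (intro sum.group) auto
    finally have *: "(\<Sum>y\<in>Z. (\<Sum>j | j \<in> J \<and> step z j = y. K z j) * g y) = avg g z" .
    have "(\<Sum>y\<in>Z. (if y = z then 1 else 0) * g y) = g z"
      using z finite_Z by (simp add: if_distrib[of "\<lambda>c. c * _"] sum.delta' cong: if_cong)
    with * show ?thesis
      by (simp add: A_def left_diff_distrib sum_subtractf)
  qed
  have "\<exists>g. \<forall>z\<in>Z. (\<Sum>y\<in>Z. A z y * g y) = (if z \<in> D then 0 else f z)"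
  proof (rule finite_linear_system_solvable[OF finite_Z])
    fix g assume "\<forall>z\<in>Z. (\<Sum>y\<in>Z. A z y * g y) = 0"
    then have g: "g z = (if z \<in> D then 0 else avg g z)" if "z \<in> Z" for z using A that by simp
    show "\<forall>z\<in>Z. g z = 0"
    proof
      fix z assume z: "z \<in> Z"
      have "g z \<le> 0" by (rule max_principle[OF D _ _ z]) (use g in auto)
      moreover have "- g z \<le> 0"
        by (rule max_principle[OF D _ _ z]) (use g in \<open>auto simp: avg_minus\<close>)
      ultimately show "g z = 0" by simp
    qed
  qed
  then obtain g where "\<forall>z\<in>Z. g z - (if z \<in> D then 0 else avg g z) = (if z \<in> D then 0 else f z)"
    using A by auto
  then show ?thesis by (intro exI[of _ g]) (auto simp: algebra_simps)
qed

text \<open>Off \<open>d\<close> every \<open>G - \<mu> * H\<close> solves the equation, where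
  \<open>G\<close> has source \<open>f\<close>, \<open>H\<close> has source 1 and both vanish at
  \<open>d\<close>. The equation at \<open>d\<close> then fixes \<open>\<mu>\<close>.\<close>

lemma poisson_solvable:
  assumes d: "\<And>C. absorbing C \<Longrightarrow> d \<in> C" and dZ: "d \<in> Z"
  shows "\<exists>G \<mu>. \<forall>z\<in>Z. G z + \<mu> = f z + avg G z"
proof -
  have D: "\<And>C. absorbing C \<Longrightarrow> C \<inter> {d} \<noteq> {}" using d by auto
  obtain G where G: "G d = 0" "\<And>z. z \<in> Z - {d} \<Longrightarrow> G z = f z + avg G z"
    using dirichlet_solvable[OF D, of f] dZ by auto
  obtain H where H: "H d = 0" "\<And>z. z \<in> Z - {d} \<Longrightarrow> H z = 1 + avg H z"
    using dirichlet_solvable[OF D, of "\<lambda>_. 1"] dZ by auto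
  \<comment> \<open>\<open>H\<close> is the mean hitting time of \<open>d\<close>. Its nonnegativity
    makes the denominator \<open>1 + avg H d\<close>, the mean return time, positive.\<close>
  have "- H z \<le> 0" if "z \<in> Z" for z
    by (rule max_principle[OF D _ _ that]) (use H in \<open>auto simp: avg_minus\<close>)
  then have Hd: "avg H d \<ge> 0"
    unfolding avg_def by (intro sum_nonneg mult_nonneg_nonneg K_nonneg dZ) (auto simp: step_in dZ)
  define \<mu> where "\<mu> = (f d + avg G d) / (1 + avg H d)"
  have "\<mu> * (1 + avg H d) = f d + avg G d" using Hd by (simp add: \<mu>_def)
  then have "(G z - \<mu> * H z) + \<mu> = f z + avg (\<lambda>z. G z - \<mu> * H z) z" if "z \<in> Z" for z
    using G H that by (cases "z = d") (auto simp: avg_diff avg_cmult algebra_simps)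
  then show ?thesis by (intro exI[of _ "\<lambda>z. G z - \<mu> * H z"] exI[of _ \<mu>]) blast
qed

text \<open>If \<open>\<mu> \<le> 0\<close>, then \<open>- G\<close> is subharmonic, so the
  minimizers of \<open>G\<close> form an absorbing set. At a minimizer with \<open>f z > 0\<close>
  the inequality is strict, and the average of \<open>- G\<close> would exceed its maximum.\<close>

lemma poisson_pos:
  assumes eq: "\<And>z. z \<in> Z \<Longrightarrow> G z + \<mu> = f z + avg G z" and f: "\<And>z. z \<in> Z \<Longrightarrow> 0 \<le> f z"
    and ne: "Z \<noteq> {}" and nz: "\<And>C. absorbing C \<Longrightarrow> \<exists>z\<in>C. f z \<noteq> 0"
  shows "\<mu> > 0"
proof (rule ccontr)
  assume \<mu>: "\<not> \<mu> > 0"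
  let ?G = "\<lambda>z. - G z"
  let ?C = "{z \<in> Z. ?G z = Max (?G ` Z)}"
  have "absorbing ?C"
  proof (rule argmax_absorbing[OF ne])
    fix z assume "z \<in> ?C"
    then show "?G z \<le> avg ?G z" using eq[of z] f[of z] \<mu> by (simp add: avg_minus)
  qed
  with nz obtain z where z: "z \<in> Z" "?G z = Max (?G ` Z)" "f z \<noteq> 0" by blast
  have "avg ?G z \<le> (\<Sum>j\<in>J. K z j * Max (?G ` Z))"
    unfolding avg_def using z finite_Z by (intro sum_mono mult_left_mono K_nonneg) (auto simp: step_in)
  also have "\<dots> = Max (?G ` Z)" using z by (simp add: sum_distrib_right[symmetric] K_sum)
  finally show False using z eq[OF z(1)] f[OF z(1)] \<mu> by (simp add: avg_minus)
qed

end

section \<open>A strong law for finite Markov chains\<close>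

text \<open>If \<open>m\<close> is the integer square root of \<open>n\<close>, at most
  \<open>2 * m\<close> summands separate the partial sums at \<open>m^2\<close> and
  \<open>n\<close>. They contribute at most \<open>2 * m * C\<close>, which is negligible against
  \<open>n \<ge> m^2\<close>.\<close>

lemma average_tendsto_0_if_squares:
  fixes a :: "nat \<Rightarrow> real"
  assumes bd: "\<And>k. \<bar>a k\<bar> \<le> C"
    and sq: "(\<lambda>n. (\<Sum>k<(Suc n)\<^sup>2. a k) / real ((Suc n)\<^sup>2)) \<longlonglongrightarrow> 0"
  shows "(\<lambda>n. (\<Sum>k<n. a k) / real n) \<longlonglongrightarrow> 0"
proof -
  define b where "b m = \<bar>(\<Sum>k<m\<^sup>2. a k) / real (m\<^sup>2)\<bar> + 2 * C / real m" for m
  have C: "C \<ge> 0" using bd[of 0] by linarith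
  have "(\<lambda>m. (\<Sum>k<m\<^sup>2. a k) / real (m\<^sup>2)) \<longlonglongrightarrow> 0"
    by (rule filterlim_sequentially_Suc[THEN iffD1, OF sq])
  moreover have "(\<lambda>m. 2 * C / real m) \<longlonglongrightarrow> 0" by (rule lim_const_over_n)
  ultimately have b0: "b \<longlonglongrightarrow> 0"
    unfolding b_def using tendsto_add[OF tendsto_rabs_zero, of _ sequentially _ 0] by fastforce
  have bound: "\<bar>(\<Sum>k<n. a k) / real n\<bar> \<le> b (floor_sqrt n)" if n: "n \<ge> 1" for n
  proof -
    define m where "m = floor_sqrt n"
    have m1: "m \<ge> 1" using n by (simp add: m_def Suc_leI)
    have m2: "m\<^sup>2 \<le> n" "n < (Suc m)\<^sup>2"
      by (simp_all add: m_def floor_sqrt_power2_le Suc_floor_sqrt_power2_gt)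
    have "(\<Sum>k<n. a k) = (\<Sum>k<m\<^sup>2. a k) + (\<Sum>k=m\<^sup>2..<n. a k)"
      using sum.atLeastLessThan_concat[OF _ m2(1), of 0 a] by (simp add: atLeast0LessThan)
    then have "\<bar>\<Sum>k<n. a k\<bar> \<le> \<bar>\<Sum>k<m\<^sup>2. a k\<bar> + \<bar>\<Sum>k=m\<^sup>2..<n. a k\<bar>" by linarith
    also have "\<bar>\<Sum>k=m\<^sup>2..<n. a k\<bar> \<le> (\<Sum>k=m\<^sup>2..<n. C)"
      by (rule order.trans[OF sum_abs]) (intro sum_mono bd)
    also have "\<dots> = real (n - m\<^sup>2) * C" by simp
    also have "\<dots> \<le> real (2 * m) * C"
    proof (intro mult_right_mono C of_nat_mono)
      show "n - m\<^sup>2 \<le> 2 * m" using m2 by (simp add: power2_eq_square)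
    qed
    finally have *: "\<bar>\<Sum>k<n. a k\<bar> \<le> \<bar>\<Sum>k<m\<^sup>2. a k\<bar> + 2 * real m * C" by simp
    have "\<bar>(\<Sum>k<n. a k) / real n\<bar> \<le> (\<bar>\<Sum>k<m\<^sup>2. a k\<bar> + 2 * real m * C) / real n"
      using * n by (simp add: abs_divide divide_right_mono)
    also have "\<dots> \<le> (\<bar>\<Sum>k<m\<^sup>2. a k\<bar> + 2 * real m * C) / real (m\<^sup>2)"
      using n m1 m2 C by (intro divide_left_mono add_nonneg_nonneg mult_pos_pos mult_nonneg_nonneg) auto
    also have "\<dots> = b m"
      using m1 by (simp add: b_def abs_divide add_divide_distrib power2_eq_square)
    finally show ?thesis by (simp add: m_def)
  qed
  have "filterlim floor_sqrt at_top sequentially"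
    unfolding filterlim_at_top
  proof
    fix K :: nat
    show "\<forall>\<^sub>F n in sequentially. K \<le> floor_sqrt n"
      using eventually_ge_at_top[of "K\<^sup>2"] by eventually_elim (simp add: le_floor_sqrt_iff)
  qed
  then have "(\<lambda>n. b (floor_sqrt n)) \<longlonglongrightarrow> 0" by (rule filterlim_compose[OF b0])
  then show ?thesis
    by (rule Lim_null_comparison[rotated])
      (auto intro!: eventually_mono[OF eventually_ge_at_top[of 1]] dest: bound)
qed

text \<open>At the times \<open>m^2\<close> the squared averages have expectation at most
  \<open>B / m^2\<close>. This is summable, so the series of squared averages is almost surely
  finite and its terms tend to 0. Boundedness fills the gaps between squares.\<close>

lemma (in prob_space) strong_law_second_moment:
  fixes D :: "nat \<Rightarrow> 'a \<Rightarrow> real"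
  assumes meas[measurable]: "\<And>k. D k \<in> borel_measurable M"
    and bd: "\<And>k \<omega>. \<omega> \<in> space M \<Longrightarrow> \<bar>D k \<omega>\<bar> \<le> C"
    and var: "\<And>n. expectation (\<lambda>\<omega>. (\<Sum>k<n. D k \<omega>)\<^sup>2) \<le> B * real n"
  shows "AE \<omega> in M. (\<lambda>n. (\<Sum>k<n. D k \<omega>) / real n) \<longlonglongrightarrow> 0"
proof -
  define f where "f n \<omega> = ((\<Sum>k<(Suc n)\<^sup>2. D k \<omega>) / real ((Suc n)\<^sup>2))\<^sup>2" for n \<omega>
  have [measurable]: "f n \<in> borel_measurable M" for n unfolding f_def by measurable
  have sumbd: "\<bar>\<Sum>k<n. D k \<omega>\<bar> \<le> real n * C" if "\<omega> \<in> space M" for n \<omega>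
    using order.trans[OF sum_abs sum_mono[of "{..<n}" "\<lambda>k. \<bar>D k \<omega>\<bar>" "\<lambda>_. C"]] bd[OF that] by simp
  have int: "integrable M (\<lambda>\<omega>. (\<Sum>k<n. D k \<omega>)\<^sup>2)" for n
  proof (rule integrable_const_bound[of _ "(real n * C)\<^sup>2"])
    show "AE \<omega> in M. norm ((\<Sum>k<n. D k \<omega>)\<^sup>2) \<le> (real n * C)\<^sup>2"
      using sumbd by (intro AE_I2) (simp add: abs_le_square_iff[symmetric] order.trans[OF _ abs_ge_self])
  qed measurable
  have B: "B \<ge> 0"
  proof -
    have "0 \<le> expectation (\<lambda>\<omega>. (\<Sum>k<1. D k \<omega>)\<^sup>2)" by (rule integral_nonneg_AE) simp
    also have "\<dots> \<le> B * real 1" by (rule var)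
    finally show ?thesis by simp
  qed
  have nn: "(\<integral>\<^sup>+\<omega>. ennreal (f n \<omega>) \<partial>M) \<le> ennreal (B * (1 / real (Suc n) ^ 2))" for n
  proof -
    have feq: "f n = (\<lambda>\<omega>. (\<Sum>k<(Suc n)\<^sup>2. D k \<omega>)\<^sup>2 / (real ((Suc n)\<^sup>2))\<^sup>2)"
      by (auto simp: f_def power_divide)
    have "(\<integral>\<^sup>+\<omega>. ennreal (f n \<omega>) \<partial>M) = ennreal (expectation (f n))"
      by (rule nn_integral_eq_integral) (auto simp: feq int)
    also have "expectation (f n) = expectation (\<lambda>\<omega>. (\<Sum>k<(Suc n)\<^sup>2. D k \<omega>)\<^sup>2) / (real ((Suc n)\<^sup>2))\<^sup>2"
      by (simp add: feq)
    also have "\<dots> \<le> B * real ((Suc n)\<^sup>2) / (real ((Suc n)\<^sup>2))\<^sup>2"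
      by (intro divide_right_mono var) simp
    also have "\<dots> = B * (1 / real (Suc n) ^ 2)"
      unfolding of_nat_power by (simp add: power2_eq_square del: of_nat_Suc)
    finally show ?thesis by (simp add: ennreal_leI)
  qed
  have summ: "summable (\<lambda>n. B * (1 / real (Suc n) ^ 2))"
  proof (rule summable_mult)
    show "summable (\<lambda>n. 1 / real (Suc n) ^ 2)"
      using summable_Suc_iff[of "\<lambda>n. inverse (real n ^ 2)"] inverse_power_summable[of 2, where 'a=real]
      by (simp add: inverse_eq_divide)
  qed
  have "(\<integral>\<^sup>+\<omega>. (\<Sum>n. ennreal (f n \<omega>)) \<partial>M) = (\<Sum>n. \<integral>\<^sup>+\<omega>. ennreal (f n \<omega>) \<partial>M)"
    by (rule nn_integral_suminf) measurable
  also have "\<dots> \<le> (\<Sum>n. ennreal (B * (1 / real (Suc n) ^ 2)))"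
    by (intro suminf_le nn) auto
  also have "\<dots> = ennreal (\<Sum>n. B * (1 / real (Suc n) ^ 2))"
    by (rule suminf_ennreal2[OF _ summ]) (use B in auto)
  finally have "(\<integral>\<^sup>+\<omega>. (\<Sum>n. ennreal (f n \<omega>)) \<partial>M) \<noteq> \<infinity>" by (auto simp: top_unique)
  then have "AE \<omega> in M. (\<Sum>n. ennreal (f n \<omega>)) \<noteq> \<infinity>"
    by (intro nn_integral_PInf_AE) auto
  then show ?thesis
  proof (rule AE_mp, intro AE_I2 impI)
    fix \<omega> assume \<omega>: "\<omega> \<in> space M" and fin: "(\<Sum>n. ennreal (f n \<omega>)) \<noteq> \<infinity>"
    have "summable (\<lambda>n. f n \<omega>)"
      by (rule summable_suminf_not_top) (use fin in \<open>auto simp: f_def\<close>)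
    then have "(\<lambda>n. f n \<omega>) \<longlonglongrightarrow> 0" by (rule summable_LIMSEQ_zero)
    then have "(\<lambda>n. sqrt (f n \<omega>)) \<longlonglongrightarrow> 0" using tendsto_real_sqrt by fastforce
    then have "(\<lambda>n. (\<Sum>k<(Suc n)\<^sup>2. D k \<omega>) / real ((Suc n)\<^sup>2)) \<longlonglongrightarrow> 0"
      unfolding f_def real_sqrt_abs by (rule tendsto_rabs_zero_cancel)
    then show "(\<lambda>n. (\<Sum>k<n. D k \<omega>) / real n) \<longlonglongrightarrow> 0"
      by (rule average_tendsto_0_if_squares[OF bd[OF \<omega>]])
  qed
qed

section \<open>Martingale increments and average payoff of a finite chain\<close>

locale finite_markov_chain =
  fixes M :: "'w measure" and S :: "'s set" and P :: "nat \<Rightarrow> 's \<Rightarrow> 's \<Rightarrow> real" and Y :: "nat \<Rightarrow> 'w \<Rightarrow> 's"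
  assumes chain: "markov_chain M S P Y" and finite_S: "finite S"

sublocale finite_markov_chain \<subseteq> prob_space M
  using chain by (simp add: markov_chain_def)

context finite_markov_chain
begin

lemma Y_in: "\<omega> \<in> space M \<Longrightarrow> Y k \<omega> \<in> S"
  using chain by (auto simp: markov_chain_def dest!: measurable_space)

lemma markov_property:
  "\<lbrakk>\<forall>k\<le>n. y k \<in> S; z \<in> S; \<P>(\<omega> in M. \<forall>k\<le>n. Y k \<omega> = y k) > 0\<rbrakk>
    \<Longrightarrow> \<P>(\<omega> in M. Y (Suc n) \<omega> = z \<bar> \<forall>k\<le>n. Y k \<omega> = y k) = P n (y n) z"
  using chain unfolding markov_chain_def by simp

lemma single_sets: "s \<in> S \<Longrightarrow> {\<omega> \<in> space M. Y k \<omega> = s} \<in> sets M"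
  using chain measurable_sets[of "Y k" M "count_space S" "{s}"]
  by (auto simp: markov_chain_def vimage_def Int_def conj_commute)

lemma history_sets:
  assumes "\<And>k. k \<le> n \<Longrightarrow> y k \<in> S"
  shows "{\<omega> \<in> space M. \<forall>k\<le>n. Y k \<omega> = y k} \<in> sets M"
proof -
  have "{\<omega> \<in> space M. \<forall>k\<le>n. Y k \<omega> = y k} = (\<Inter>k\<in>{..n}. {\<omega> \<in> space M. Y k \<omega> = y k})" by auto
  also have "\<dots> \<in> sets M" using assms by (intro sets.finite_INT single_sets) auto
  finally show ?thesis .
qed

definition history :: "nat \<Rightarrow> (nat \<Rightarrow> 's) \<Rightarrow> 'w set" where
  "history n y = {\<omega> \<in> space M. \<forall>k\<le>n. Y k \<omega> = y k}"

text \<open>Each outcome realizes exactly one of the finitely many histories up to time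
  \<open>n\<close>. Functionals of the path up to time \<open>n\<close> are therefore finite
  combinations of indicators, which reduces measurability and expectations to finite sums.\<close>

lemma sum_histories:
  fixes F :: "(nat \<Rightarrow> 's) \<Rightarrow> real"
  assumes \<omega>: "\<omega> \<in> space M"
    and F: "\<And>y y'. (\<And>k. k \<le> n \<Longrightarrow> y k = y' k) \<Longrightarrow> F y = F y'"
  shows "F (\<lambda>k. Y k \<omega>) = (\<Sum>y\<in>{..n} \<rightarrow>\<^sub>E S. F y * indicator (history n y) \<omega>)"
proof -
  let ?y = "restrict (\<lambda>k. Y k \<omega>) {..n}"
  have y: "?y \<in> {..n} \<rightarrow>\<^sub>E S" using Y_in[OF \<omega>] by auto
  have ind: "indicator (history n y) \<omega> = (if y = ?y then 1 else (0::real))" if "y \<in> {..n} \<rightarrow>\<^sub>E S" for y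
  proof -
    have "\<omega> \<in> history n y \<longleftrightarrow> (\<forall>k\<le>n. Y k \<omega> = y k)" using \<omega> by (simp add: history_def)
    also have "\<dots> \<longleftrightarrow> (\<forall>k\<in>{..n}. y k = ?y k)" by auto
    also have "\<dots> \<longleftrightarrow> y = ?y" using PiE_ext[OF that y] by auto
    finally show ?thesis by (simp add: indicator_def)
  qed
  have "(\<Sum>y\<in>{..n} \<rightarrow>\<^sub>E S. F y * indicator (history n y) \<omega>)
      = (\<Sum>y\<in>{..n} \<rightarrow>\<^sub>E S. if y = ?y then F y else 0)"
    by (intro sum.cong refl) (simp add: ind)
  also have "\<dots> = F ?y" using y finite_S by (simp add: sum.delta' finite_PiE)
  also have "\<dots> = F (\<lambda>k. Y k \<omega>)" by (rule F[of ?y "\<lambda>k. Y k \<omega>"]) simp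
  finally show ?thesis by simp
qed

lemma measurable_history:
  fixes F :: "(nat \<Rightarrow> 's) \<Rightarrow> real"
  assumes F: "\<And>y y'. (\<And>k. k \<le> n \<Longrightarrow> y k = y' k) \<Longrightarrow> F y = F y'"
  shows "(\<lambda>\<omega>. F (\<lambda>k. Y k \<omega>)) \<in> borel_measurable M"
proof -
  have "(\<lambda>\<omega>. \<Sum>y\<in>{..n} \<rightarrow>\<^sub>E S. F y * indicator (history n y) \<omega>) \<in> borel_measurable M"
  proof (rule borel_measurable_sum)
    fix y assume "y \<in> {..n} \<rightarrow>\<^sub>E S"
    then have "history n y \<in> sets M" unfolding history_def by (intro history_sets) auto
    then show "(\<lambda>\<omega>. F y * indicator (history n y) \<omega>) \<in> borel_measurable M" by simp
  qed
  moreover have "F (\<lambda>k. Y k \<omega>) = (\<Sum>y\<in>{..n} \<rightarrow>\<^sub>E S. F y * indicator (history n y) \<omega>)"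
    if "\<omega> \<in> space M" for \<omega>
    using that F by (rule sum_histories)
  ultimately show ?thesis by (rule measurable_cong[THEN iffD2, rotated])
qed

text \<open>For a history of positive probability this is the Markov property multiplied out. On
  null histories, about which the Markov property says nothing, both sides vanish.\<close>

lemma transition_mass:
  assumes y: "\<And>k. k \<le> n \<Longrightarrow> y k \<in> S" and t: "t \<in> S"
  shows "prob (history n y \<inter> {\<omega> \<in> space M. Y (Suc n) \<omega> = t}) = prob (history n y) * P n (y n) t"
proof -
  let ?A = "history n y \<inter> {\<omega> \<in> space M. Y (Suc n) \<omega> = t}"
  have H: "history n y \<in> sets M" unfolding history_def using y by (rule history_sets)
  show ?thesis
  proof (cases "prob (history n y) = 0")
    case True
    have "prob ?A \<le> prob (history n y)"
      by (rule finite_measure_mono[OF Int_lower1 H])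
    with True have "prob ?A = 0" using measure_nonneg[of M ?A] by linarith
    with True show ?thesis by simp
  next
    case False
    then have pos: "prob (history n y) > 0" by (simp add: zero_less_measure_iff)
    have A: "?A = {\<omega> \<in> space M. Y (Suc n) \<omega> = t \<and> (\<forall>k\<le>n. Y k \<omega> = y k)}"
      unfolding history_def by blast
    have "\<P>(\<omega> in M. Y (Suc n) \<omega> = t \<bar> \<forall>k\<le>n. Y k \<omega> = y k) = P n (y n) t"
      by (rule markov_property) (use y t pos in \<open>simp_all add: history_def\<close>)
    then have "prob ?A / prob (history n y) = P n (y n) t"
      by (simp only: cond_prob_def A) (simp only: history_def)
    then show ?thesis using nonzero_divide_eq_eq[OF False] by (simp add: mult.commute)
  qed
qed

text \<open>Given a history, \<open>F\<close> is constant while the increment \<open>\<phi>\<close>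
  has mean zero. Summing over histories shows that the increment is orthogonal to every functional
  of the past.\<close>

lemma increment_orthogonal:
  fixes F :: "(nat \<Rightarrow> 's) \<Rightarrow> real"
  assumes F: "\<And>y y'. (\<And>k. k \<le> n \<Longrightarrow> y k = y' k) \<Longrightarrow> F y = F y'"
    and \<phi>: "\<And>s. s \<in> S \<Longrightarrow> (\<Sum>t\<in>S. P n s t * \<phi> s t) = 0"
  shows "expectation (\<lambda>\<omega>. F (\<lambda>k. Y k \<omega>) * \<phi> (Y n \<omega>) (Y (Suc n) \<omega>)) = 0"
proof -
  let ?E = "\<lambda>y t. history n y \<inter> {\<omega> \<in> space M. Y (Suc n) \<omega> = t}"
  have E_sets: "?E y t \<in> sets M" if "y \<in> {..n} \<rightarrow>\<^sub>E S" "t \<in> S" for y t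
    using that unfolding history_def by (intro sets.Int history_sets single_sets) auto
  have "F (\<lambda>k. Y k \<omega>) * \<phi> (Y n \<omega>) (Y (Suc n) \<omega>)
      = (\<Sum>y\<in>{..n} \<rightarrow>\<^sub>E S. \<Sum>t\<in>S. F y * \<phi> (y n) t * indicator (?E y t) \<omega>)" if \<omega>: "\<omega> \<in> space M" for \<omega>
  proof -
    have "F (\<lambda>k. Y k \<omega>) * \<phi> (Y n \<omega>) (Y (Suc n) \<omega>)
        = (\<Sum>y\<in>{..n} \<rightarrow>\<^sub>E S. F y * \<phi> (y n) (Y (Suc n) \<omega>) * indicator (history n y) \<omega>)"
      by (rule sum_histories[OF \<omega>, of n "\<lambda>y. F y * \<phi> (y n) (Y (Suc n) \<omega>)"]) (metis F order_refl)
    also have "\<dots> = (\<Sum>y\<in>{..n} \<rightarrow>\<^sub>E S. \<Sum>t\<in>S. F y * \<phi> (y n) t * indicator (?E y t) \<omega>)"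
    proof (intro sum.cong refl)
      fix y
      have "(\<Sum>t\<in>S. F y * \<phi> (y n) t * indicator (?E y t) \<omega>)
          = (\<Sum>t\<in>S. if t = Y (Suc n) \<omega> then F y * \<phi> (y n) t * indicator (history n y) \<omega> else 0)"
        using \<omega> by (intro sum.cong refl) (auto simp: indicator_def)
      then show "F y * \<phi> (y n) (Y (Suc n) \<omega>) * indicator (history n y) \<omega>
          = (\<Sum>t\<in>S. F y * \<phi> (y n) t * indicator (?E y t) \<omega>)"
        using Y_in[OF \<omega>] finite_S by (simp add: sum.delta')
    qed
    finally show ?thesis .
  qed
  then have "expectation (\<lambda>\<omega>. F (\<lambda>k. Y k \<omega>) * \<phi> (Y n \<omega>) (Y (Suc n) \<omega>))
      = expectation (\<lambda>\<omega>. \<Sum>y\<in>{..n} \<rightarrow>\<^sub>E S. \<Sum>t\<in>S. F y * \<phi> (y n) t * indicator (?E y t) \<omega>)"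
    by (intro Bochner_Integration.integral_cong) auto
  also have "\<dots> = (\<Sum>y\<in>{..n} \<rightarrow>\<^sub>E S. \<Sum>t\<in>S. expectation (\<lambda>\<omega>. F y * \<phi> (y n) t * indicator (?E y t) \<omega>))"
  proof -
    have int: "integrable M (\<lambda>\<omega>. F y * \<phi> (y n) t * indicator (?E y t) \<omega>)"
      if "y \<in> {..n} \<rightarrow>\<^sub>E S" "t \<in> S" for y t
      using E_sets[OF that] by (intro integrable_mult_right integrable_real_indicator) (simp_all add: less_top[symmetric])
    have "expectation (\<lambda>\<omega>. \<Sum>y\<in>{..n} \<rightarrow>\<^sub>E S. \<Sum>t\<in>S. F y * \<phi> (y n) t * indicator (?E y t) \<omega>)
        = (\<Sum>y\<in>{..n} \<rightarrow>\<^sub>E S. expectation (\<lambda>\<omega>. \<Sum>t\<in>S. F y * \<phi> (y n) t * indicator (?E y t) \<omega>))"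
      by (intro Bochner_Integration.integral_sum Bochner_Integration.integrable_sum int)
    also have "\<dots> = (\<Sum>y\<in>{..n} \<rightarrow>\<^sub>E S. \<Sum>t\<in>S. expectation (\<lambda>\<omega>. F y * \<phi> (y n) t * indicator (?E y t) \<omega>))"
      by (intro sum.cong refl Bochner_Integration.integral_sum int)
    finally show ?thesis .
  qed
  also have "\<dots> = (\<Sum>y\<in>{..n} \<rightarrow>\<^sub>E S. F y * prob (history n y) * (\<Sum>t\<in>S. P n (y n) t * \<phi> (y n) t))"
  proof (intro sum.cong refl)
    fix y assume y: "y \<in> {..n} \<rightarrow>\<^sub>E S"
    have yS: "y k \<in> S" if "k \<le> n" for k using y that by (auto simp: PiE_iff)
    have ind: "expectation (\<lambda>\<omega>. c * indicator A \<omega>) = c * prob A" if "A \<in> sets M" for c :: real and A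
      using that by simp
    have *: "expectation (\<lambda>\<omega>. F y * \<phi> (y n) t * indicator (?E y t) \<omega>)
        = F y * prob (history n y) * (P n (y n) t * \<phi> (y n) t)" if t: "t \<in> S" for t
    proof -
      have b: "prob (?E y t) = prob (history n y) * P n (y n) t"
        by (rule transition_mass[OF yS t])
      show ?thesis
        unfolding ind[OF E_sets[OF y t]] b by (simp only: mult_ac)
    qed
    then show "(\<Sum>t\<in>S. expectation (\<lambda>\<omega>. F y * \<phi> (y n) t * indicator (?E y t) \<omega>))
        = F y * prob (history n y) * (\<Sum>t\<in>S. P n (y n) t * \<phi> (y n) t)"
      unfolding sum_distrib_left by (intro sum.cong refl *)
  qed
  also have "\<dots> = 0" using \<phi> by (intro sum.neutral) (auto simp: PiE_iff)
  finally show ?thesis .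
qed

text \<open>Orthogonality removes the cross terms when the square of the sum is expanded, so the
  second moment grows at most linearly.\<close>

theorem martingale_strong_law:
  fixes \<phi> :: "nat \<Rightarrow> 's \<Rightarrow> 's \<Rightarrow> real"
  assumes \<phi>: "\<And>n s. s \<in> S \<Longrightarrow> (\<Sum>t\<in>S. P n s t * \<phi> n s t) = 0"
    and bd: "\<And>n s t. s \<in> S \<Longrightarrow> t \<in> S \<Longrightarrow> \<bar>\<phi> n s t\<bar> \<le> C"
  shows "AE \<omega> in M. (\<lambda>n. (\<Sum>k<n. \<phi> k (Y k \<omega>) (Y (Suc k) \<omega>)) / real n) \<longlonglongrightarrow> 0"
proof -
  define D where "D k \<omega> = \<phi> k (Y k \<omega>) (Y (Suc k) \<omega>)" for k \<omega>
  have meas[measurable]: "D k \<in> borel_measurable M" for k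
    unfolding D_def using measurable_history[of "Suc k" "\<lambda>y. \<phi> k (y k) (y (Suc k))"] by auto
  have bdD: "\<bar>D k \<omega>\<bar> \<le> C" if "\<omega> \<in> space M" for k \<omega>
    unfolding D_def using that by (intro bd Y_in)
  have sumbd: "\<bar>\<Sum>k<n. D k \<omega>\<bar> \<le> real n * C" if "\<omega> \<in> space M" for n \<omega>
    using order.trans[OF sum_abs sum_mono[of "{..<n}" "\<lambda>k. \<bar>D k \<omega>\<bar>" "\<lambda>_. C"]] bdD[OF that] by simp
  have sq: "x\<^sup>2 \<le> c\<^sup>2" if "\<bar>x\<bar> \<le> c" for x c :: real
    using power_mono[OF that abs_ge_zero, of 2] by simp
  have i1: "integrable M (\<lambda>\<omega>. (\<Sum>k<n. D k \<omega>)\<^sup>2)" for n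
  proof (rule integrable_const_bound)
    show "AE \<omega> in M. norm ((\<Sum>k<n. D k \<omega>)\<^sup>2) \<le> (real n * C)\<^sup>2"
      unfolding real_norm_def abs_power2 by (intro AE_I2 sq sumbd)
  qed measurable
  have i2: "integrable M (\<lambda>\<omega>. (D n \<omega>)\<^sup>2)" for n
  proof (rule integrable_const_bound)
    show "AE \<omega> in M. norm ((D n \<omega>)\<^sup>2) \<le> C\<^sup>2"
      unfolding real_norm_def abs_power2 by (intro AE_I2 sq bdD)
  qed measurable
  have i3: "integrable M (\<lambda>\<omega>. (\<Sum>k<n. D k \<omega>) * D n \<omega>)" for n
  proof (rule integrable_const_bound[of _ "(real n * C) * C"])
    have "\<bar>\<Sum>k<n. D k \<omega>\<bar> * \<bar>D n \<omega>\<bar> \<le> real n * C * C" if "\<omega> \<in> space M" for \<omega>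
      using sumbd[OF that, of n] bdD[OF that, of n] by (intro mult_mono) auto
    then show "AE \<omega> in M. norm ((\<Sum>k<n. D k \<omega>) * D n \<omega>) \<le> real n * C * C"
      by (intro AE_I2) (simp add: abs_mult)
  qed measurable
  have "expectation (\<lambda>\<omega>. (\<Sum>k<n. D k \<omega>)\<^sup>2) \<le> C\<^sup>2 * real n" for n
  proof (induction n)
    case (Suc n)
    have orth: "expectation (\<lambda>\<omega>. (\<Sum>k<n. D k \<omega>) * D n \<omega>) = 0"
      unfolding D_def
      by (rule increment_orthogonal[where F="\<lambda>y. \<Sum>k<n. \<phi> k (y k) (y (Suc k))"])
         (auto intro!: sum.cong \<phi>)
    have "expectation (\<lambda>\<omega>. (\<Sum>k<Suc n. D k \<omega>)\<^sup>2)
        = expectation (\<lambda>\<omega>. (\<Sum>k<n. D k \<omega>)\<^sup>2 + (2 * ((\<Sum>k<n. D k \<omega>) * D n \<omega>) + (D n \<omega>)\<^sup>2))"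
      by (simp add: power2_sum algebra_simps)
    also have "\<dots> = expectation (\<lambda>\<omega>. (\<Sum>k<n. D k \<omega>)\<^sup>2) + expectation (\<lambda>\<omega>. (D n \<omega>)\<^sup>2)"
      using i1 i2 i3 orth by simp
    also have "expectation (\<lambda>\<omega>. (D n \<omega>)\<^sup>2) \<le> expectation (\<lambda>\<omega>. C\<^sup>2)"
      by (intro integral_mono i2 sq bdD) simp_all
    finally show ?case using Suc.IH by (simp add: prob_space algebra_simps)
  qed simp
  then show ?thesis
    using strong_law_second_moment[of D C "C\<^sup>2"] bdD unfolding D_def[symmetric] by simp
qed

text \<open>By \<open>poisson\<close>, the payoff plus the change of \<open>g\<close>, less
  \<open>\<mu>\<close>, is a martingale increment. The changes of \<open>g\<close> telescope to a
  bounded term that vanishes on division by \<open>n\<close>. The time dependence of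
  \<open>g\<close> accommodates periodic patterns.\<close>

theorem average_payoff:
  fixes w :: "'s \<Rightarrow> 's \<Rightarrow> real" and g :: "nat \<Rightarrow> 's \<Rightarrow> real"
  assumes stoch: "\<And>n s. s \<in> S \<Longrightarrow> (\<Sum>t\<in>S. P n s t) = 1"
    and poisson: "\<And>n s. s \<in> S \<Longrightarrow> g n s + \<mu> = (\<Sum>t\<in>S. P n s t * (w s t + g (Suc n) t))"
    and bw: "\<And>s t. s \<in> S \<Longrightarrow> t \<in> S \<Longrightarrow> \<bar>w s t\<bar> \<le> C" and bg: "\<And>n s. s \<in> S \<Longrightarrow> \<bar>g n s\<bar> \<le> B"
  shows "AE \<omega> in M. (\<lambda>n. (\<Sum>k<n. w (Y k \<omega>) (Y (Suc k) \<omega>)) / real n) \<longlonglongrightarrow> \<mu>"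
proof -
  define \<phi> where "\<phi> n s t = (w s t + g (Suc n) t) - (g n s + \<mu>)" for n s t
  have "(\<Sum>t\<in>S. P n s t * \<phi> n s t) = 0" if s: "s \<in> S" for n s
  proof -
    have "(\<Sum>t\<in>S. P n s t * \<phi> n s t)
        = (\<Sum>t\<in>S. P n s t * (w s t + g (Suc n) t)) - (\<Sum>t\<in>S. P n s t) * (g n s + \<mu>)"
      unfolding \<phi>_def sum_distrib_right sum_subtractf[symmetric]
      by (intro sum.cong refl) (rule right_diff_distrib)
    then show ?thesis unfolding stoch[OF s] poisson[OF s, symmetric] by simp
  qed
  moreover have "\<bar>\<phi> n s t\<bar> \<le> (C + B) + (B + \<bar>\<mu>\<bar>)" if "s \<in> S" "t \<in> S" for n s t
  proof -
    have "\<bar>\<phi> n s t\<bar> \<le> \<bar>w s t + g (Suc n) t\<bar> + \<bar>g n s + \<mu>\<bar>"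
      unfolding \<phi>_def by (rule abs_triangle_ineq4)
    also have "\<dots> \<le> (\<bar>w s t\<bar> + \<bar>g (Suc n) t\<bar>) + (\<bar>g n s\<bar> + \<bar>\<mu>\<bar>)"
      by (intro add_mono abs_triangle_ineq)
    also have "\<dots> \<le> (C + B) + (B + \<bar>\<mu>\<bar>)"
      by (rule add_mono[OF add_mono[OF bw[OF that] bg[OF that(2)]] add_mono[OF bg[OF that(1)] order_refl]])
    finally show ?thesis .
  qed
  ultimately have "AE \<omega> in M. (\<lambda>n. (\<Sum>k<n. \<phi> k (Y k \<omega>) (Y (Suc k) \<omega>)) / real n) \<longlonglongrightarrow> 0"
    by (rule martingale_strong_law[of \<phi>])
  then show ?thesis
  proof (rule AE_mp, intro AE_I2 impI)
    fix \<omega> assume \<omega>: "\<omega> \<in> space M"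
      and lim: "(\<lambda>n. (\<Sum>k<n. \<phi> k (Y k \<omega>) (Y (Suc k) \<omega>)) / real n) \<longlonglongrightarrow> 0"
    have tele: "(\<Sum>k<n. \<phi> k (Y k \<omega>) (Y (Suc k) \<omega>))
       = (\<Sum>k<n. w (Y k \<omega>) (Y (Suc k) \<omega>)) + g n (Y n \<omega>) - g 0 (Y 0 \<omega>) - real n * \<mu>" for n
      by (induction n) (auto simp: \<phi>_def algebra_simps)
    have "(\<lambda>n. (g 0 (Y 0 \<omega>) - g n (Y n \<omega>)) / real n) \<longlonglongrightarrow> 0"
    proof (rule Lim_null_comparison)
      show "\<forall>\<^sub>F n in sequentially. norm ((g 0 (Y 0 \<omega>) - g n (Y n \<omega>)) / real n) \<le> 2 * B / real n"
      proof (intro always_eventually allI)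
        fix n
        have "\<bar>g 0 (Y 0 \<omega>) - g n (Y n \<omega>)\<bar> \<le> 2 * B"
          using bg[OF Y_in[OF \<omega>], of 0 0] bg[OF Y_in[OF \<omega>], of n n] by linarith
        then show "norm ((g 0 (Y 0 \<omega>) - g n (Y n \<omega>)) / real n) \<le> 2 * B / real n"
          by (simp add: abs_divide divide_right_mono)
      qed
    qed (rule lim_const_over_n)
    from tendsto_add[OF tendsto_add[OF lim this] tendsto_const[of \<mu>]]
    have "(\<lambda>n. (\<Sum>k<n. \<phi> k (Y k \<omega>) (Y (Suc k) \<omega>)) / real n
        + (g 0 (Y 0 \<omega>) - g n (Y n \<omega>)) / real n + \<mu>) \<longlonglongrightarrow> \<mu>" by simp
    then show "(\<lambda>n. (\<Sum>k<n. w (Y k \<omega>) (Y (Suc k) \<omega>)) / real n) \<longlonglongrightarrow> \<mu>"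
    proof (rule Lim_transform_eventually)
      show "\<forall>\<^sub>F n in sequentially. (\<Sum>k<n. \<phi> k (Y k \<omega>) (Y (Suc k) \<omega>)) / real n
          + (g 0 (Y 0 \<omega>) - g n (Y n \<omega>)) / real n + \<mu>
          = (\<Sum>k<n. w (Y k \<omega>) (Y (Suc k) \<omega>)) / real n"
        using eventually_gt_at_top[of 0] by eventually_elim (simp add: tele field_simps)
    qed
  qed
qed

end

section \<open>Existence of a chain with given transition matrices, by the Ionescu-Tulcea
  construction\<close>

lemma markov_chain_exists:
  fixes S :: "'s set" and P :: "nat \<Rightarrow> 's \<Rightarrow> 's \<Rightarrow> real"
  assumes fin: "finite S" and s0: "s0 \<in> S"
    and nonneg: "\<And>n s t. s \<in> S \<Longrightarrow> t \<in> S \<Longrightarrow> 0 \<le> P n s t"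
    and stoch: "\<And>n s. s \<in> S \<Longrightarrow> (\<Sum>t\<in>S. P n s t) = 1"
  shows "\<exists>(M :: (nat \<Rightarrow> 's) measure) Y. markov_chain M S P Y"
proof -
  \<comment> \<open>The law of coordinate \<open>n\<close> given the earlier ones. Coordinate 0 is
    \<open>s0\<close>; coordinate \<open>Suc m\<close> is governed by \<open>P m\<close> and reads
    only the coordinate before it.\<close>
  define w where "w n \<omega> t = (case n of 0 \<Rightarrow> if t = s0 then 1 else 0 | Suc m \<Rightarrow> P m (\<omega> m) t)"
    for n :: nat and \<omega> :: "nat \<Rightarrow> 's" and t
  define \<kappa> where "\<kappa> n \<omega> = point_measure S (\<lambda>t. ennreal (w n \<omega> t))" for n \<omega>
  \<comment> \<open>Finite products of the discrete sigma-algebra on a finite set are discrete, so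
    the kernels are automatically measurable.\<close>
  have PiM: "PiM {0..<n} (\<lambda>_. count_space S) = count_space ({0..<n} \<rightarrow>\<^sub>E S)" for n :: nat
    by (rule count_space_PiM_finite) (use fin in \<open>auto simp: countable_finite\<close>)
  have w0: "0 \<le> w n \<omega> t" if "\<omega> \<in> {0..<n} \<rightarrow>\<^sub>E S" "t \<in> S" for n \<omega> t
    using that by (cases n) (auto simp: w_def PiE_iff intro!: nonneg)
  have w1: "(\<Sum>t\<in>S. w n \<omega> t) = 1" if "\<omega> \<in> {0..<n} \<rightarrow>\<^sub>E S" for n \<omega>
    using that fin s0 by (cases n) (auto simp: w_def PiE_iff intro!: stoch)
  have \<kappa>_prob: "prob_space (\<kappa> n \<omega>)" if \<omega>: "\<omega> \<in> {0..<n} \<rightarrow>\<^sub>E S" for n \<omega>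
  proof (rule prob_spaceI)
    have "emeasure (\<kappa> n \<omega>) S = ennreal (\<Sum>t\<in>S. w n \<omega> t)"
      using w0[OF \<omega>] fin by (simp add: \<kappa>_def emeasure_point_measure_finite)
    then show "emeasure (\<kappa> n \<omega>) (space (\<kappa> n \<omega>)) = 1"
      using w1[OF \<omega>] by (simp add: \<kappa>_def space_point_measure)
  qed
  interpret IT: Ionescu_Tulcea \<kappa> "\<lambda>_. count_space S"
  proof (rule Ionescu_Tulcea.intro)
    fix n and \<omega> :: "nat \<Rightarrow> 's"
    have "subprob_space (\<kappa> n \<omega>) \<and> sets (\<kappa> n \<omega>) = Pow S" if "\<omega> \<in> {0..<n} \<rightarrow>\<^sub>E S" for \<omega>
      using prob_space_imp_subprob_space[OF \<kappa>_prob[OF that]] by (simp add: \<kappa>_def sets_point_measure)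
    then show "\<kappa> n \<in> PiM {0..<n} (\<lambda>_. count_space S) \<rightarrow>\<^sub>M subprob_algebra (count_space S)"
      unfolding PiM by (simp add: space_subprob_algebra)
    show "prob_space (\<kappa> n \<omega>)" if "\<omega> \<in> space (PiM {0..<n} (\<lambda>_. count_space S))"
      using that unfolding PiM by (intro \<kappa>_prob) simp
  qed
  have \<kappa>_single: "emeasure (\<kappa> n \<omega>) {t} = ennreal (w n \<omega> t)" if "t \<in> S" for n \<omega> t
    unfolding \<kappa>_def using that fin by (subst emeasure_point_measure_finite) simp_all
  \<comment> \<open>The probability that coordinates \<open>0, ..., n - 1\<close> agree with
    \<open>y\<close>. The product formula \<open>c_Suc\<close> and the identification
    \<open>hist\<close> reduce conditional probabilities to quotients of values of
    \<open>c\<close>.\<close>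
  define c where "c n y = emeasure (IT.C 0 n (\<lambda>_. undefined)) {restrict y {0..<n}}" for n and y :: "nat \<Rightarrow> 's"
  have c_Suc: "c (Suc n) y = c n y * ennreal (w n (restrict y {0..<n}) (y n))"
    if y: "\<And>k. k < Suc n \<Longrightarrow> y k \<in> S" for n y
  proof -
    let ?r = "restrict y {0..<n}" and ?r' = "restrict y {0..<Suc n}"
    have r: "?r \<in> {0..<n} \<rightarrow>\<^sub>E S" "?r' \<in> {0..<Suc n} \<rightarrow>\<^sub>E S" using y by auto
    have sp: "space (IT.C 0 n (\<lambda>_. undefined)) = {0..<n} \<rightarrow>\<^sub>E S"
      using IT.space_C[of "\<lambda>_. undefined" 0 n] by (simp add: PiM)
    have st: "sets (IT.C 0 n (\<lambda>_. undefined)) = Pow ({0..<n} \<rightarrow>\<^sub>E S)"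
      using IT.sets_C[of "\<lambda>_. undefined" 0 n] by (simp add: PiM)
    have C_meas: "IT.C 0 n (\<lambda>_. undefined) \<rightarrow>\<^sub>M L = PiM {0..<n} (\<lambda>_. count_space S) \<rightarrow>\<^sub>M L" for L :: "(nat \<Rightarrow> 's) measure measure"
      by (rule measurable_cong_sets[OF _ refl]) (use IT.sets_C[of "\<lambda>_. undefined" 0 n] in simp)
    \<comment> \<open>Among the paths of length \<open>n\<close> only the truncation
      \<open>?r\<close> can be extended to \<open>?r'\<close>, so the integrand below is supported
      at a single point.\<close>
    have eP: "emeasure (IT.eP n \<omega>) {?r'} = ennreal (w n ?r (y n)) * indicator {?r} \<omega>"
      if \<omega>: "\<omega> \<in> {0..<n} \<rightarrow>\<^sub>E S" for \<omega>
    proof -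
      have "emeasure (IT.eP n \<omega>) {?r'} = emeasure (\<kappa> n \<omega>) ((\<lambda>x. fun_upd \<omega> n x) -` {?r'} \<inter> S)"
        using IT.emeasure_eP[of \<omega> n "{?r'}"] \<omega> r(2)
        unfolding PiM space_count_space sets_count_space by blast
      also have "(\<lambda>x. fun_upd \<omega> n x) -` {?r'} \<inter> S = (if \<omega> = ?r then {y n} else {})"
      proof -
        have "fun_upd \<omega> n x = ?r' \<longleftrightarrow> \<omega> = ?r \<and> x = y n" for x
        proof
          assume eq: "fun_upd \<omega> n x = ?r'"
          have "\<omega> k = ?r k" for k
          proof (cases "k < n")
            case True
            then show ?thesis using fun_cong[OF eq, of k] by simp
          next
            case False
            then show ?thesis using PiE_arb[OF \<omega>, of k] by simp
          qed
          moreover have "x = y n" using fun_cong[OF eq, of n] by simp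
          ultimately show "\<omega> = ?r \<and> x = y n" by blast
        qed (auto simp: fun_eq_iff)
        then show ?thesis
          unfolding vimage_def singleton_iff using y[of n] by (cases "\<omega> = ?r") auto
      qed
      also have "emeasure (\<kappa> n \<omega>) \<dots> = ennreal (w n ?r (y n)) * indicator {?r} \<omega>"
        using \<kappa>_single[of "y n" n ?r] y[of n] by (cases "\<omega> = ?r") simp_all
      finally show ?thesis .
    qed
    have "c (Suc n) y = (\<integral>\<^sup>+\<omega>. emeasure (IT.eP n \<omega>) {?r'} \<partial>IT.C 0 n (\<lambda>_. undefined))"
      unfolding c_def IT.C.simps
    proof (subst emeasure_bind)
      show "space (IT.C 0 n (\<lambda>_. undefined)) \<noteq> {}" unfolding sp using r(1) by blast
      show "IT.eP (0 + n) \<in> IT.C 0 n (\<lambda>_. undefined) \<rightarrow>\<^sub>M subprob_algebra (PiM {0..<Suc n} (\<lambda>_. count_space S))"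
        unfolding C_meas using IT.measurable_eP[of n] by (simp only: add_0)
      show "{?r'} \<in> sets (PiM {0..<Suc n} (\<lambda>_. count_space S))" using r(2) by (simp add: PiM)
    qed (simp only: add_0)
    also have "\<dots> = (\<integral>\<^sup>+\<omega>. ennreal (w n ?r (y n)) * indicator {?r} \<omega> \<partial>IT.C 0 n (\<lambda>_. undefined))"
      by (intro nn_integral_cong) (simp add: sp eP)
    also have "\<dots> = ennreal (w n ?r (y n)) * c n y"
      unfolding c_def using r(1) by (intro nn_integral_cmult_indicator) (simp add: st)
    finally show ?thesis by (simp add: mult.commute)
  qed
  let ?M = "IT.PF.lim" and ?Y = "\<lambda>n \<omega>. \<omega> n"
  have hist: "emeasure ?M {\<omega> \<in> space ?M. \<forall>k<n. \<omega> k = y k} = c n y"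
    if y: "\<And>k. k < n \<Longrightarrow> y k \<in> S" for n y
  proof -
    let ?r = "restrict y {0..<n}"
    have r: "{?r} \<in> sets (PiM {0..<n} (\<lambda>_. count_space S))" using y by (auto simp: PiM)
    have "IT.PF.emb UNIV {0..<n} {?r} = {\<omega> \<in> space ?M. \<forall>k<n. \<omega> k = y k}"
    proof -
      have "restrict \<omega> {0..<n} = ?r \<longleftrightarrow> (\<forall>k<n. \<omega> k = y k)" for \<omega>
      proof
        assume eq: "restrict \<omega> {0..<n} = ?r"
        show "\<forall>k<n. \<omega> k = y k" using fun_cong[OF eq] by (metis atLeastLessThan_iff le0 restrict_apply')
      qed (auto simp: fun_eq_iff)
      then show ?thesis unfolding prod_emb_def by (auto simp: space_PiM)
    qed
    moreover have "IT.PF.emb {0..<n} {0..<n} {?r} = {?r}"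
      using y by (intro prod_emb_id) (auto simp: space_PiM)
    ultimately show ?thesis
      using IT.lim[OF _ r] IT.emeasure_CI[OF _ r, of n] by (simp add: c_def)
  qed
  have prob: "prob_space ?M"
  proof (rule prob_spaceI)
    have "emeasure ?M (space ?M) = c 0 (\<lambda>_. undefined)"
      using hist[of 0 "\<lambda>_. undefined"] by simp
    also have "\<dots> = 1" by (simp add: c_def PiM_empty)
    finally show "emeasure ?M (space ?M) = 1" .
  qed
  have measure_of: "measure ?M A = enn2real u" if "emeasure ?M A = u" for A u
    unfolding Sigma_Algebra.measure_def that by (rule refl)
  have "markov_chain ?M S P ?Y"
    unfolding markov_chain_def
  proof (intro conjI allI impI prob)
    show "?Y n \<in> ?M \<rightarrow>\<^sub>M count_space S" for n
      unfolding measurable_cong_sets[OF IT.PF.sets_lim refl]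
      by (rule measurable_component_singleton) simp
    fix n y z
    assume y: "\<forall>k\<le>n. y k \<in> S" and z: "z \<in> S" and pos: "0 < \<P>(\<omega> in ?M. \<forall>k\<le>n. \<omega> k = y k)"
    \<comment> \<open>Appending \<open>z\<close> at time \<open>Suc n\<close> turns the joint event
      into a history as well; by \<open>c_Suc\<close> the two probabilities differ by the factor
      \<open>P n (y n) z\<close>.\<close>
    let ?y = "y(Suc n := z)"
    have A: "measure ?M {\<omega> \<in> space ?M. \<forall>k\<le>n. \<omega> k = y k} = enn2real (c (Suc n) y)"
    proof -
      have yS: "y k \<in> S" if "k < Suc n" for k using y that by simp
      have "{\<omega> \<in> space ?M. \<forall>k\<le>n. \<omega> k = y k} = {\<omega> \<in> space ?M. \<forall>k<Suc n. \<omega> k = y k}"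
        by (simp only: less_Suc_eq_le)
      then show ?thesis unfolding Sigma_Algebra.measure_def by (simp only: hist[of "Suc n" y, OF yS])
    qed
    have y': "?y k \<in> S" if "k < Suc (Suc n)" for k
      using y z that by (cases "k = Suc n") auto
    have sets_eq: "{\<omega> \<in> space ?M. \<omega> (Suc n) = z \<and> (\<forall>k\<le>n. \<omega> k = y k)} = {\<omega> \<in> space ?M. \<forall>k<Suc (Suc n). \<omega> k = ?y k}"
    proof (intro Collect_cong conj_cong refl)
      fix \<omega> :: "nat \<Rightarrow> 's"
      have "(\<forall>k<Suc (Suc n). \<omega> k = ?y k) \<longleftrightarrow> \<omega> (Suc n) = z \<and> (\<forall>k<Suc n. \<omega> k = ?y k)"
        unfolding All_less_Suc[of "Suc n"] by simp
      also have "(\<forall>k<Suc n. \<omega> k = ?y k) \<longleftrightarrow> (\<forall>k\<le>n. \<omega> k = y k)"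
        unfolding less_Suc_eq_le by (intro all_cong) simp
      finally show "(\<omega> (Suc n) = z \<and> (\<forall>k\<le>n. \<omega> k = y k)) = (\<forall>k<Suc (Suc n). \<omega> k = ?y k)" by blast
    qed
    have em: "emeasure ?M {\<omega> \<in> space ?M. \<omega> (Suc n) = z \<and> (\<forall>k\<le>n. \<omega> k = y k)} = c (Suc (Suc n)) ?y"
      unfolding sets_eq by (rule hist[of "Suc (Suc n)" ?y, OF y'])
    have "measure ?M {\<omega> \<in> space ?M. \<omega> (Suc n) = z \<and> (\<forall>k\<le>n. \<omega> k = y k)} = enn2real (c (Suc (Suc n)) ?y)"
      by (rule measure_of[OF em])
    also have "c (Suc (Suc n)) ?y = c (Suc n) ?y * ennreal (w (Suc n) (restrict ?y {0..<Suc n}) (?y (Suc n)))"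
      by (rule c_Suc[of "Suc n" ?y, OF y'])
    also have "w (Suc n) (restrict ?y {0..<Suc n}) (?y (Suc n)) = P n (y n) z"
      by (simp add: w_def)
    also have "c (Suc n) ?y = c (Suc n) y"
      unfolding c_def by (intro arg_cong2[where f=emeasure] refl arg_cong[where f="\<lambda>u. {u}"]) auto
    finally have B: "measure ?M {\<omega> \<in> space ?M. \<omega> (Suc n) = z \<and> (\<forall>k\<le>n. \<omega> k = y k)}
        = enn2real (c (Suc n) y) * P n (y n) z"
      using nonneg[of "y n" z n] y z by (simp add: enn2real_mult)
    show "\<P>(\<omega> in ?M. \<omega> (Suc n) = z \<bar> \<forall>k\<le>n. \<omega> k = y k) = P n (y n) z"
      using pos A B by (simp add: cond_prob_def)
  qed
  then show ?thesis by (intro exI[of _ ?M] exI[of _ ?Y])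
qed

section \<open>The spatially dependent games\<close>

definition coin :: "real \<Rightarrow> nat \<Rightarrow> real" where
  "coin c b = (if b = 1 then c else 1 - c)"

lemma statusD:
  assumes "x \<in> statuses N" and "i \<in> {1..N}"
  shows "x i = 0 \<or> x i = 1"
  using assms by (auto simp: statuses_def PiE_iff)

lemma status_update:
  assumes "x \<in> statuses N" and "i \<in> {1..N}" and "b \<in> {0, 1}"
  shows "x(i := b) \<in> statuses N"
  using assms unfolding statuses_def by (auto simp: PiE_iff extensional_def)

lemma finite_statuses: "finite (statuses N)"
  unfolding statuses_def by (intro finite_PiE) auto

lemma finite_states: "finite (states N)"
  unfolding states_def by (intro finite_cartesian_product finite_statuses finite_atLeastAtMost)

lemma left_of_in: "i \<in> {1..N} \<Longrightarrow> left_of N i \<in> {1..N}"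
  and right_of_in: "i \<in> {1..N} \<Longrightarrow> right_of N i \<in> {1..N}"
  by (auto simp: left_of_def right_of_def)

text \<open>Heads makes a winner and tails a loser whatever the old status, so flipping and staying
  become the two outcomes of one toss.\<close>

lemma game_eq_coins:
  assumes x: "x \<in> statuses N" and i: "i \<in> {1..N}"
  shows "game N q (x, i) (y, j) = (if y = x(i := 1) then q (nbrs N x i) / real N else 0)
    + (if y = x(i := 0) then (1 - q (nbrs N x i)) / real N else 0)"
proof -
  have ne: "x(i := 1) \<noteq> x(i := 0)" by (metis fun_upd_same zero_neq_one)
  from statusD[OF x i] show ?thesis
  proof
    assume "x i = 0"
    then have "flip x i = x(i := 1)" "x = x(i := 0)" by (auto simp: flip_def)
    with ne \<open>x i = 0\<close> show ?thesis unfolding game_def by auto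
  next
    assume "x i = 1"
    then have "flip x i = x(i := 0)" "x = x(i := 1)" by (auto simp: flip_def)
    with ne \<open>x i = 1\<close> show ?thesis unfolding game_def by auto
  qed
qed

text \<open>A turn is won exactly when its player ends as a winner, so the old status drops
  out.\<close>

lemma payoff_eq:
  assumes x: "x \<in> statuses N" and i: "i \<in> {1..N}" and b: "b \<in> {0, 1}"
  shows "payoff (x, i) (x(i := b), j) = 2 * real b - 1"
proof -
  have ne: "x(i := 1) \<noteq> x(i := 0)" by (metis fun_upd_same zero_neq_one)
  from statusD[OF x i] show ?thesis
  proof
    assume "x i = 0"
    then have "flip x i = x(i := 1)" "x = x(i := 0)" by (auto simp: flip_def)
    with ne b \<open>x i = 0\<close> show ?thesis unfolding payoff_def by auto
  next
    assume "x i = 1"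
    then have "flip x i = x(i := 0)" "x = x(i := 1)" by (auto simp: flip_def)
    with ne b \<open>x i = 1\<close> show ?thesis unfolding payoff_def by auto
  qed
qed

text \<open>The next player is uniform and independent of the coin, so a row of the matrix splits
  into a toss followed by an average over \<open>j\<close>.\<close>

lemma sum_game:
  assumes x: "x \<in> statuses N" and i: "i \<in> {1..N}"
  shows "(\<Sum>t\<in>states N. game N q (x, i) t * \<phi> t)
    = (\<Sum>b\<in>{0, 1}. coin (q (nbrs N x i)) b * ((\<Sum>j=1..N. \<phi> (x(i := b), j)) / real N))"
proof -
  have pick: "(\<Sum>y\<in>statuses N. if y = x(i := b) then F y else 0) = F (x(i := b))"
    if "b \<in> {0, 1}" for b and F :: "status \<Rightarrow> real"
    using finite_statuses status_update[OF x i that] by (simp add: sum.delta')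
  have "(\<Sum>t\<in>states N. game N q (x, i) t * \<phi> t)
      = (\<Sum>y\<in>statuses N. \<Sum>j=1..N. game N q (x, i) (y, j) * \<phi> (y, j))"
    unfolding states_def by (simp add: sum.cartesian_product)
  also have "\<dots> = (\<Sum>y\<in>statuses N.
      (if y = x(i := 1) then \<Sum>j=1..N. q (nbrs N x i) / real N * \<phi> (y, j) else 0)
      + (if y = x(i := 0) then \<Sum>j=1..N. (1 - q (nbrs N x i)) / real N * \<phi> (y, j) else 0))"
    unfolding game_eq_coins[OF x i]
    by (intro sum.cong refl) (auto simp: distrib_right sum.distrib)
  also have "\<dots> = (\<Sum>j=1..N. q (nbrs N x i) / real N * \<phi> (x(i := 1), j))
      + (\<Sum>j=1..N. (1 - q (nbrs N x i)) / real N * \<phi> (x(i := 0), j))"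
    by (simp only: sum.distrib pick insertI1 insertI2 singletonI insert_iff simp_thms)
  finally show ?thesis by (simp add: coin_def sum_distrib_left[symmetric] sum_divide_distrib[symmetric] add_divide_distrib)
qed

lemma sum_game_eq_1:
  assumes "x \<in> statuses N" and "i \<in> {1..N}"
  shows "(\<Sum>t\<in>states N. game N q (x, i) t) = 1"
  using sum_game[OF assms, of q "\<lambda>_. 1"] assms(2) by (simp add: coin_def)

lemma game_nonneg:
  assumes "x \<in> statuses N" and "i \<in> {1..N}" and "0 \<le> q (nbrs N x i)" "q (nbrs N x i) \<le> 1"
  shows "0 \<le> game N q (x, i) t"
  using assms(3,4) by (cases t) (simp add: game_eq_coins[OF assms(1,2)])

section \<open>Mean profit of the patterns \<open>A^r B\<close> through a reduced walk\<close>

lemma mean_profit_eqI: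
  assumes \<mu>: "is_mean_profit N P \<mu>"
    and chain: "\<exists>(M :: (nat \<Rightarrow> state) measure) Y. markov_chain M (states N) P Y"
  shows "mean_profit N P = \<mu>"
  unfolding mean_profit_def
proof (rule the_equality[of "is_mean_profit N P" \<mu>, OF \<mu>])
  fix \<nu> assume \<nu>: "is_mean_profit N P \<nu>"
  \<comment> \<open>Without any chain, \<open>is_mean_profit\<close> would hold vacuously of every
    number. An actual chain makes the almost sure limit unique.\<close>
  obtain M :: "(nat \<Rightarrow> state) measure" and Y where MY: "markov_chain M (states N) P Y"
    using chain by (elim exE)
  interpret prob_space M using MY by (simp add: markov_chain_def)
  have a: "AE \<omega> in M. (\<lambda>n. total_profit Y n \<omega> / real n) \<longlonglongrightarrow> \<mu>"
    using \<mu> MY unfolding is_mean_profit_def by simp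
  have b: "AE \<omega> in M. (\<lambda>n. total_profit Y n \<omega> / real n) \<longlonglongrightarrow> \<nu>"
    using \<nu> MY unfolding is_mean_profit_def by simp
  have "AE \<omega> in M. \<nu> = \<mu>"
    using a b by eventually_elim (rule LIMSEQ_unique)
  then show "\<nu> = \<mu>" by simp
qed

text \<open>The pattern is \<open>r\<close> turns of game A followed by one turn of game B. The case
  \<open>r = 0\<close> is game B alone, so both mean profits are treated together.\<close>

locale pattern_game =
  fixes N r :: nat and p :: "nat \<Rightarrow> real"
  assumes N: "N \<ge> 3" and p0: "p 0 = 1" and p12: "p 1 = p 2"
    and p1: "1/2 < p 1" "p 1 < 1" and p3: "p 3 = 0"
begin

definition heads :: "nat \<Rightarrow> nat \<Rightarrow> real" where
  "heads a = (if a < r then (\<lambda>_. 1/2) else p)"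

definition kernel :: "nat \<Rightarrow> state \<Rightarrow> state \<Rightarrow> real" where
  "kernel n = game N (heads (n mod Suc r))"

text \<open>A state of the reduced walk is a status vector with a phase in \<open>{..r}\<close>. The
  next player is not part of it but is drawn within the move \<open>(i, b)\<close>, along with his
  resulting status \<open>b\<close>.\<close>

definition K :: "status \<times> nat \<Rightarrow> nat \<times> nat \<Rightarrow> real" where
  "K = (\<lambda>(x, a) (i, b). coin (heads a (nbrs N x i)) b / real N)"

definition step :: "status \<times> nat \<Rightarrow> nat \<times> nat \<Rightarrow> status \<times> nat" where
  "step = (\<lambda>(x, a) (i, b). (x(i := b), Suc a mod Suc r))"

lemma p_2: "p 2 = p (Suc 0)" using p12 by simp

lemma nbrs_cases:
  assumes "x \<in> statuses N" "i \<in> {1..N}"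
  shows "nbrs N x i \<in> {0, 1, 2, 3}"
  using statusD[OF assms(1) left_of_in[OF assms(2)]] statusD[OF assms(1) right_of_in[OF assms(2)]]
  by (auto simp: nbrs_def)

lemma heads_bounds:
  assumes "x \<in> statuses N" "i \<in> {1..N}"
  shows "0 \<le> heads a (nbrs N x i)" "heads a (nbrs N x i) \<le> 1"
proof -
  have "0 \<le> p m \<and> p m \<le> 1" if "m \<in> {0, 1, 2, 3}" for m
    using that p0 p1 p3 p_2 by auto
  from this[OF nbrs_cases[OF assms]]
  show "0 \<le> heads a (nbrs N x i)" "heads a (nbrs N x i) \<le> 1" by (simp_all add: heads_def)
qed

sublocale random_moves "statuses N \<times> {..r}" "{1..N} \<times> {0, 1}" K step
proof
  show "finite (statuses N \<times> {..r})" by (simp add: finite_statuses)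
  show "finite ({1..N} \<times> {0, 1::nat})" by simp
  fix z assume "z \<in> statuses N \<times> {..r}"
  then obtain x a where z: "z = (x, a)" "x \<in> statuses N" "a \<le> r" by auto
  show "(\<Sum>j\<in>{1..N} \<times> {0, 1}. K z j) = 1"
  proof -
    have "(\<Sum>j\<in>{1..N} \<times> {0, 1}. K z j) = (\<Sum>i=1..N. \<Sum>b\<in>{0, 1}. K z (i, b))"
      by (simp only: sum.cartesian_product split_def prod.collapse)
    also have "\<dots> = (\<Sum>i=1..N. 1 / real N)"
      by (intro sum.cong refl) (simp add: K_def z coin_def diff_divide_distrib)
    also have "\<dots> = 1" using N by simp
    finally show ?thesis .
  qed
  fix j assume "j \<in> {1..N} \<times> {0, 1::nat}"
  then obtain i b where j: "j = (i, b)" "i \<in> {1..N}" "b \<in> {0, 1}" by auto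
  show "0 \<le> K z j"
    using heads_bounds[OF z(2) j(2), of a] by (simp add: K_def z j(1) coin_def)
  show "step z j \<in> statuses N \<times> {..r}"
    using status_update[OF z(2) j(2,3)] by (simp add: step_def z j(1) less_Suc_eq_le[symmetric])
qed

lemma avg_eq:
  "avg G (x, a) = (\<Sum>i=1..N. \<Sum>b\<in>{0, 1}. coin (heads a (nbrs N x i)) b * G (x(i := b), Suc a mod Suc r)) / real N"
proof -
  have "avg G (x, a) = (\<Sum>i=1..N. \<Sum>b\<in>{0, 1}. K (x, a) (i, b) * G (step (x, a) (i, b)))"
    unfolding avg_def by (simp only: sum.cartesian_product split_def prod.collapse)
  then show ?thesis
    by (simp add: K_def step_def sum_divide_distrib add_divide_distrib)
qed

text \<open>The expected payoff of a turn, which is the source term of the Poisson equation.\<close>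

definition reward :: "status \<times> nat \<Rightarrow> real" where
  "reward = (\<lambda>(x, a). (\<Sum>i=1..N. 2 * heads a (nbrs N x i) - 1) / real N)"

lemma kernel_stochastic: "s \<in> states N \<Longrightarrow> (\<Sum>t\<in>states N. kernel n s t) = 1"
  unfolding kernel_def by (cases s) (simp only: states_def mem_Sigma_iff sum_game_eq_1[unfolded states_def])

lemma kernel_nonneg: "s \<in> states N \<Longrightarrow> 0 \<le> kernel n s t"
  unfolding kernel_def by (cases s) (auto simp: states_def intro!: game_nonneg heads_bounds)

lemma kernel_chain_exists: "\<exists>(M :: (nat \<Rightarrow> state) measure) Y. markov_chain M (states N) kernel Y"
proof (rule markov_chain_exists[OF finite_states])
  show "(restrict (\<lambda>_. 0) {1..N}, 1) \<in> states N" using N by (auto simp: states_def statuses_def)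
qed (simp_all add: kernel_stochastic kernel_nonneg)

text \<open>The reduced walk forgets who plays next. Its Poisson solution is lifted to the full
  chain by conditioning on that player, after which \<open>average_payoff\<close> applies.\<close>

lemma mean_profit_eq:
  assumes poisson: "\<And>z. z \<in> statuses N \<times> {..r} \<Longrightarrow> G z + \<mu> = reward z + avg G z"
  shows "mean_profit N kernel = \<mu>"
proof (rule mean_profit_eqI[OF _ kernel_chain_exists])
  \<comment> \<open>The relative value when the next player \<open>i\<close> is known: expected
    payoff plus subsequent \<open>G\<close>, less \<open>\<mu>\<close>. By the Poisson equation,
    averaging over \<open>i\<close> gives back \<open>G\<close>.\<close>
  define h where "h a = (\<lambda>(x, i). (\<Sum>b\<in>{0, 1}. coin (heads a (nbrs N x i)) b
    * (2 * real b - 1 + G (x(i := b), Suc a mod Suc r))) - \<mu>)" for a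
  have h_avg: "(\<Sum>j=1..N. h a (x, j)) / real N = G (x, a)" if x: "x \<in> statuses N" and a: "a \<le> r" for x a
  proof -
    have "h a (x, j) = (2 * heads a (nbrs N x j) - 1)
        + (\<Sum>b\<in>{0, 1}. coin (heads a (nbrs N x j)) b * G (x(j := b), Suc a mod Suc r)) - \<mu>" for j
      by (simp add: h_def coin_def algebra_simps)
    then have "(\<Sum>j=1..N. h a (x, j)) / real N = reward (x, a) + avg G (x, a) - \<mu>"
      unfolding avg_eq reward_def prod.case
      using N by (simp add: sum.distrib sum_subtractf add_divide_distrib diff_divide_distrib)
    then show ?thesis using poisson[of "(x, a)"] x a by simp
  qed
  define g where "g n = h (n mod Suc r)" for n
  have step_eq: "g n s + \<mu> = (\<Sum>t\<in>states N. kernel n s t * (payoff s t + g (Suc n) t))"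
    if s: "s \<in> states N" for n s
  proof -
    obtain x i where xi: "s = (x, i)" "x \<in> statuses N" "i \<in> {1..N}"
      using s by (auto simp: states_def)
    let ?a = "n mod Suc r"
    have a: "Suc n mod Suc r = Suc ?a mod Suc r" "Suc n mod Suc r \<le> r"
      using mod_less_divisor[of "Suc r" "Suc n"] by (simp_all add: mod_Suc_eq less_Suc_eq_le)
    have inner: "(\<Sum>j=1..N. payoff (x, i) (x(i := b), j) + g (Suc n) (x(i := b), j)) / real N
        = 2 * real b - 1 + G (x(i := b), Suc ?a mod Suc r)" if b: "b \<in> {0, 1}" for b
    proof -
      have "(\<Sum>j=1..N. payoff (x, i) (x(i := b), j) + g (Suc n) (x(i := b), j)) / real N
          = (\<Sum>j=1..N. 2 * real b - 1) / real N + (\<Sum>j=1..N. h (Suc n mod Suc r) (x(i := b), j)) / real N"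
        by (simp only: payoff_eq[OF xi(2,3) b] g_def sum.distrib add_divide_distrib)
      also have "(\<Sum>j=1..N. 2 * real b - 1) / real N = 2 * real b - 1"
        using N by simp
      also have "(\<Sum>j=1..N. h (Suc n mod Suc r) (x(i := b), j)) / real N = G (x(i := b), Suc n mod Suc r)"
        by (rule h_avg[OF status_update[OF xi(2,3) b] a(2)])
      finally show ?thesis unfolding a(1) .
    qed
    have "(\<Sum>t\<in>states N. kernel n s t * (payoff s t + g (Suc n) t))
        = (\<Sum>b\<in>{0, 1}. coin (heads ?a (nbrs N x i)) b *
            ((\<Sum>j=1..N. payoff (x, i) (x(i := b), j) + g (Suc n) (x(i := b), j)) / real N))"
      unfolding kernel_def xi(1) by (rule sum_game[OF xi(2,3)])
    also have "\<dots> = (\<Sum>b\<in>{0, 1}. coin (heads ?a (nbrs N x i)) b *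
            (2 * real b - 1 + G (x(i := b), Suc ?a mod Suc r)))"
      by (intro sum.cong refl arg_cong2[where f="(*)"] inner)
    also have "\<dots> = g n s + \<mu>" by (simp only: g_def h_def xi(1) prod.case diff_add_cancel)
    finally show ?thesis by (rule sym)
  qed
  \<comment> \<open>Only finitely many phases and states occur, so the time-dependent
    \<open>g\<close> is uniformly bounded.\<close>
  define B where "B = Max ((\<lambda>(a, s). \<bar>h a s\<bar>) ` ({..r} \<times> states N))"
  have B: "\<bar>g n s\<bar> \<le> B" if "s \<in> states N" for n s
  proof -
    have "n mod Suc r \<in> {..r}" using mod_less_divisor[of "Suc r" n] by simp
    then have "(\<lambda>(a, s). \<bar>h a s\<bar>) (n mod Suc r, s) \<in> (\<lambda>(a, s). \<bar>h a s\<bar>) ` ({..r} \<times> states N)"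
      using that by (intro imageI) simp
    then show ?thesis
      unfolding B_def g_def using finite_states by (intro Max_ge) simp_all
  qed
  show "is_mean_profit N kernel \<mu>"
    unfolding is_mean_profit_def
  proof (intro allI impI)
    fix M :: "(nat \<Rightarrow> state) measure" and Y
    assume "markov_chain M (states N) kernel Y"
    then interpret finite_markov_chain M "states N" kernel Y
      by unfold_locales (simp_all add: finite_states)
    have "AE \<omega> in M. (\<lambda>n. (\<Sum>k<n. payoff (Y k \<omega>) (Y (Suc k) \<omega>)) / real n) \<longlonglongrightarrow> \<mu>"
    proof (rule average_payoff[of g \<mu> payoff 1 B])
      show "\<bar>payoff s t\<bar> \<le> 1" for s t by (cases s; cases t) (simp add: payoff_def)
    qed (simp_all add: kernel_stochastic step_eq[symmetric] B)
    then show "AE \<omega> in M. (\<lambda>n. total_profit Y n \<omega> / real n) \<longlonglongrightarrow> \<mu>"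
      by (simp add: total_profit_def sum.atLeast1_atMost_eq)
  qed
qed

end

section \<open>Absorbing sets and alternating configurations\<close>

definition alternating :: "nat \<Rightarrow> nat \<Rightarrow> status" where
  "alternating N b = (\<lambda>i\<in>{1..N}. if odd i then b else 1 - b)"

lemma alternating_status: "b \<in> {0, 1} \<Longrightarrow> alternating N b \<in> statuses N"
  unfolding alternating_def statuses_def by (intro PiE_I) (auto simp: restrict_def)

context pattern_game
begin

text \<open>Beside a losing left neighbour heads has probability 1/2, \<open>p 0 = 1\<close> or
  \<open>p 1 > 0\<close>; beside a winning one tails has probability 1/2, \<open>1 - p 2 > 0\<close>
  or \<open>1 - p 3 = 1\<close>.\<close>

lemma antialigned_move:
  assumes "x \<in> statuses N" "i \<in> {1..N}"
  shows "K (x, a) (i, 1 - x (left_of N i)) > 0"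
proof -
  have "x (left_of N i) = 0 \<or> x (left_of N i) = 1" "x (right_of N i) = 0 \<or> x (right_of N i) = 1"
    using statusD[OF assms(1) left_of_in[OF assms(2)]] statusD[OF assms(1) right_of_in[OF assms(2)]]
    by simp_all
  then have "coin (heads a (nbrs N x i)) (1 - x (left_of N i)) > 0"
    using p0 p1 p3 p_2 by (auto simp: nbrs_def heads_def coin_def)
  then show ?thesis using N by (simp add: K_def)
qed

lemma fair_move: "a < r \<Longrightarrow> K (x, a) (i, b) > 0"
  using N by (simp add: K_def heads_def coin_def)

lemma absorbing_move:
  assumes C: "absorbing C" and z: "(x, a) \<in> C" and i: "i \<in> {1..N}" and b: "b \<in> {0, 1}"
    and K: "K (x, a) (i, b) > 0"
  shows "(x(i := b), Suc a mod Suc r) \<in> C"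
proof -
  have "(i, b) \<in> {1..N} \<times> {0, 1}" using i b by simp
  then have "step (x, a) (i, b) \<in> C" using C z K unfolding absorbing_def by blast
  then show ?thesis by (simp add: step_def)
qed

lemma absorbing_status:
  assumes "absorbing C" and "(x, a) \<in> C"
  shows "x \<in> statuses N" "a \<le> r"
  using assms unfolding absorbing_def by auto

lemma absorbing_antialign:
  assumes C: "absorbing C" and z: "(x, a) \<in> C" and i: "i \<in> {1..N}"
  shows "(x(i := 1 - x (left_of N i)), Suc a mod Suc r) \<in> C"
proof (rule absorbing_move[OF C z i])
  show "K (x, a) (i, 1 - x (left_of N i)) > 0"
    by (rule antialigned_move[OF absorbing_status(1)[OF C z] i])
  show "1 - x (left_of N i) \<in> {0, 1}"
    using statusD[OF absorbing_status(1)[OF C z] left_of_in[OF i]] by auto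
qed

text \<open>Every turn advances the phase cyclically, and an antialigning move is always available
  to continue inside \<open>C\<close>.\<close>

lemma absorbing_all_phases:
  assumes C: "absorbing C" and a': "a' \<le> r"
  shows "\<exists>x. (x, a') \<in> C"
proof -
  obtain x a where z: "(x, a) \<in> C" using C unfolding absorbing_def by auto
  have "\<exists>y. (y, (a + k) mod Suc r) \<in> C" for k
  proof (induction k)
    case 0
    then show ?case using z absorbing_status(2)[OF C z] by auto
  next
    case (Suc k)
    then obtain y where "(y, (a + k) mod Suc r) \<in> C" by (elim exE)
    from absorbing_antialign[OF C this, of 1] show ?case
      using N by (intro exI) (simp add: mod_Suc_eq)
  qed
  \<comment> \<open>Adding a full period before subtracting \<open>a\<close> keeps the subtraction
    of natural numbers exact.\<close>
  moreover have "a + (a' + Suc r - a) = a' + Suc r"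
    using absorbing_status(2)[OF C z] by simp
  then have "(a + (a' + Suc r - a)) mod Suc r = a'"
    using a' by (simp only: mod_add_self2 mod_less less_Suc_eq_le)
  ultimately show ?thesis by metis
qed

text \<open>Players 2, ..., \<open>N\<close> in turn take the status opposite to that of their left
  neighbour. Player 1 keeps his, which determines the resulting alternating vector.\<close>

lemma absorbing_sweep:
  assumes C: "absorbing C" and z: "(x, a) \<in> C"
  shows "\<exists>a'. (alternating N (x 1), a') \<in> C"
proof -
  let ?y = "alternating N (x 1)"
  have x1: "x 1 = 0 \<or> x 1 = 1"
    using N by (intro statusD[OF absorbing_status(1)[OF C z]]) simp
  have "k < N \<Longrightarrow> \<exists>y a'. (y, a') \<in> C \<and> (\<forall>i\<in>{1..Suc k}. y i = ?y i)" for k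
  proof (induction k)
    case 0
    then show ?case using z by (intro exI[of _ x] exI[of _ a]) (auto simp: alternating_def)
  next
    case (Suc k)
    then obtain y a' where y: "(y, a') \<in> C" "\<forall>i\<in>{1..Suc k}. y i = ?y i" by auto
    let ?i = "Suc (Suc k)"
    have i: "?i \<in> {1..N}" and l: "left_of N ?i = Suc k" using Suc.prems by (auto simp: left_of_def)
    have "(y(?i := 1 - y (Suc k)), Suc a' mod Suc r) \<in> C"
      using absorbing_antialign[OF C y(1) i] unfolding l .
    moreover have "1 - y (Suc k) = ?y ?i"
      using y(2) i x1 by (auto simp: alternating_def)
    then have "\<forall>j\<in>{1..?i}. (y(?i := 1 - y (Suc k))) j = ?y j"
      using y(2) by auto
    ultimately show ?case by (intro exI conjI)
  qed
  from this[of "N - 1"] obtain y a' where y: "(y, a') \<in> C" "\<forall>i\<in>{1..N}. y i = ?y i"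
    using N by auto
  have "y = ?y"
  proof (rule PiE_ext)
    show "y \<in> {1..N} \<rightarrow>\<^sub>E {0, 1}" using absorbing_status(1)[OF C y(1)] by (simp add: statuses_def)
    show "?y \<in> {1..N} \<rightarrow>\<^sub>E {0, 1}" using alternating_status[of "x 1" N] x1 by (auto simp: statuses_def)
    show "y i = ?y i" if "i \<in> {1..N}" for i using y(2) that by simp
  qed
  with y(1) show ?thesis by auto
qed

text \<open>Antialigning player 2 leaves an alternating vector unchanged and only advances the
  phase.\<close>

lemma absorbing_alternating_all_phases:
  assumes C: "absorbing C" and z: "(alternating N b, a) \<in> C" and a': "a' \<le> r" and b: "b \<in> {0, 1}"
  shows "(alternating N b, a') \<in> C"
proof -
  have "(alternating N b, (a + k) mod Suc r) \<in> C" for k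
  proof (induction k)
    case 0
    then show ?case using z absorbing_status(2)[OF C z] by simp
  next
    case (Suc k)
    have "left_of N 2 = 1" by (simp add: left_of_def)
    moreover have "(alternating N b)(2 := 1 - alternating N b 1) = alternating N b"
      using N by (auto simp: alternating_def fun_eq_iff)
    ultimately show ?case
      using absorbing_antialign[OF C Suc, of 2] N by (simp add: mod_Suc_eq)
  qed
  moreover have "a + (a' + Suc r - a) = a' + Suc r"
    using absorbing_status(2)[OF C z] by simp
  then have "(a + (a' + Suc r - a)) mod Suc r = a'"
    using a' by (simp only: mod_add_self2 mod_less less_Suc_eq_le)
  ultimately show ?thesis by metis
qed

lemma absorbing_contains_alternating:
  assumes C: "absorbing C"
  shows "\<exists>b\<in>{0, 1}. \<forall>a\<le>r. (alternating N b, a) \<in> C"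
proof -
  obtain x where x: "(x, 0) \<in> C" using absorbing_all_phases[OF C, of 0] by auto
  obtain a where a: "(alternating N (x 1), a) \<in> C" using absorbing_sweep[OF C x] by (elim exE)
  have "x 1 \<in> {0, 1}"
    using N statusD[OF absorbing_status(1)[OF C x], of 1] by auto
  then show ?thesis
    using absorbing_alternating_all_phases[OF C a] by blast
qed

text \<open>This supplies the common state that \<open>poisson_solvable\<close> asks for. From the
  alternating vector starting with 1, player 1 can become a loser: by a fair toss if
  \<open>r \<ge> 1\<close>, otherwise by antialigning with player \<open>N\<close>, a winner since
  \<open>N\<close> is odd. A second sweep then ends at the vector starting with 0.\<close>

lemma absorbing_contains_alternating_0:
  assumes C: "absorbing C" and r: "r \<ge> 1 \<or> odd N"
  shows "(alternating N 0, 0) \<in> C"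
proof -
  obtain b where b: "b \<in> {0, 1}" "\<forall>a\<le>r. (alternating N b, a) \<in> C"
    using absorbing_contains_alternating[OF C] by auto
  show ?thesis
  proof (cases "b = 0")
    case True
    then show ?thesis using b by simp
  next
    case False
    then have b1: "(alternating N 1, 0) \<in> C" using b by auto
    have one: "1 \<in> {1..N}" using N by simp
    have "K (alternating N 1, 0) (1, 0) > 0"
    proof (cases "r \<ge> 1")
      case True
      then show ?thesis by (intro fair_move) simp
    next
      case False
      then have "1 - alternating N 1 (left_of N 1) = 0"
        using r N by (simp add: alternating_def left_of_def)
      then show ?thesis
        using antialigned_move[OF alternating_status one, of 1 0] by simp
    qed
    from absorbing_move[OF C b1 one _ this]
    have "((alternating N 1)(1 := 0), Suc 0 mod Suc r) \<in> C" by simp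
    from absorbing_sweep[OF C this] obtain a where "(alternating N 0, a) \<in> C" by auto
    from absorbing_alternating_all_phases[OF C this] show ?thesis by simp
  qed
qed

definition wins :: "status \<Rightarrow> real" where
  "wins x = (\<Sum>i=1..N. real (x i))"

definition discord :: "status \<Rightarrow> real" where
  "discord x = (\<Sum>i=1..N. if x (left_of N i) = x (right_of N i) then 0 else 1)"

lemma discord_nonneg: "0 \<le> discord x"
  unfolding discord_def by (intro sum_nonneg) simp

lemma discord_pos:
  assumes "i \<in> {1..N}" "x (left_of N i) \<noteq> x (right_of N i)"
  shows "discord x > 0"
  unfolding discord_def using assms by (intro sum_pos2[of _ i]) auto

text \<open>Discord has to occur in phase \<open>r\<close>, when game B is played. If
  \<open>r \<ge> 1\<close>, the fair toss just before can set player 1 opposite to player 3, and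
  these are the neighbours of player 2. If \<open>r = 0\<close>, then \<open>N\<close> is odd, and
  in an alternating vector the neighbours \<open>N\<close> and 2 of player 1 differ.\<close>

lemma absorbing_discord:
  assumes C: "absorbing C" and r: "r \<ge> 1 \<or> odd N"
  shows "\<exists>x. (x, r) \<in> C \<and> discord x > 0"
proof (cases "r \<ge> 1")
  case True
  obtain x where x: "(x, r - 1) \<in> C" using absorbing_all_phases[OF C, of "r - 1"] by auto
  have phase: "Suc (r - 1) mod Suc r = r" using True by simp
  have one: "1 \<in> {1..N}" and two: "2 \<in> {1..N}" using N by auto
  have nb: "left_of N 2 = 1" "right_of N 2 = 3" using N by (auto simp: left_of_def right_of_def)
  have x3: "x 3 = 0 \<or> x 3 = 1" using N by (intro statusD[OF absorbing_status(1)[OF C x]]) simp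
  have "(x(1 := 1 - x 3), Suc (r - 1) mod Suc r) \<in> C"
    using True x3 by (intro absorbing_move[OF C x one] fair_move) auto
  moreover have "discord (x(1 := 1 - x 3)) > 0"
    by (rule discord_pos[OF two]) (use x3 in \<open>auto simp: nb\<close>)
  ultimately show ?thesis unfolding phase by (intro exI conjI)
next
  case False
  then have odd: "odd N" using r by simp
  obtain b where b: "b \<in> {0, 1}" "(alternating N b, r) \<in> C"
    using absorbing_contains_alternating[OF C] by auto
  have nb: "left_of N 1 = N" "right_of N 1 = 2" using N by (auto simp: left_of_def right_of_def)
  have "discord (alternating N b) > 0"
  proof (rule discord_pos)
    show "1 \<in> {1..N}" using N by simp
    show "alternating N b (left_of N 1) \<noteq> alternating N b (right_of N 1)"
      unfolding nb using b(1) N odd by (auto simp: alternating_def)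
  qed
  with b(2) show ?thesis by (intro exI conjI)
qed

end

section \<open>Drift of the number of winners and the corrected reward\<close>

lemma sum_left_of: "N \<ge> 1 \<Longrightarrow> (\<Sum>i=1..N. f (left_of N i)) = (\<Sum>i=1..N. f i)"
  by (rule sum.reindex_bij_witness[of _ "right_of N" "left_of N"]) (auto simp: left_of_def right_of_def)

lemma sum_right_of: "N \<ge> 1 \<Longrightarrow> (\<Sum>i=1..N. f (right_of N i)) = (\<Sum>i=1..N. f i)"
  by (rule sum.reindex_bij_witness[of _ "left_of N" "right_of N"]) (auto simp: left_of_def right_of_def)

context pattern_game
begin

text \<open>For equal neighbours \<open>p 0 = 1\<close> and \<open>p 3 = 0\<close> are exactly one
  minus their mean. For unequal ones that value is 1/2, and the last term is the excess of
  \<open>p 1 = p 2\<close> over it.\<close>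

lemma p_nbrs:
  assumes x: "x \<in> statuses N" and i: "i \<in> {1..N}"
  shows "p (nbrs N x i) = 1 - (real (x (left_of N i)) + real (x (right_of N i))) / 2
    + (p 1 - 1/2) * (if x (left_of N i) = x (right_of N i) then 0 else 1)"
  using statusD[OF x left_of_in[OF i]] statusD[OF x right_of_in[OF i]] p0 p3 p_2
  by (auto simp: nbrs_def)

text \<open>Each player is a left neighbour once and a right neighbour once, so the neighbour means
  add up to \<open>wins x\<close>.\<close>

lemma sum_p_nbrs:
  assumes x: "x \<in> statuses N"
  shows "(\<Sum>i=1..N. p (nbrs N x i)) = real N - wins x + (p 1 - 1/2) * discord x"
proof -
  have "(\<Sum>i=1..N. p (nbrs N x i)) = (\<Sum>i=1..N. 1 - (real (x (left_of N i)) + real (x (right_of N i))) / 2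
      + (p 1 - 1/2) * (if x (left_of N i) = x (right_of N i) then 0 else 1))"
    by (intro sum.cong refl p_nbrs x)
  also have "\<dots> = real N - ((\<Sum>i=1..N. real (x (left_of N i))) + (\<Sum>i=1..N. real (x (right_of N i)))) / 2
      + (p 1 - 1/2) * discord x"
    by (simp only: sum.distrib sum_subtractf sum_divide_distrib[symmetric] sum_distrib_left[symmetric]
        discord_def) simp
  also have "(\<Sum>i=1..N. real (x (left_of N i))) = wins x"
    unfolding wins_def using N by (intro sum_left_of[of N "\<lambda>i. real (x i)"]) simp
  also have "(\<Sum>i=1..N. real (x (right_of N i))) = wins x"
    unfolding wins_def using N by (intro sum_right_of[of N "\<lambda>i. real (x i)"]) simp
  finally show ?thesis by simp
qed

lemma wins_update:
  assumes "i \<in> {1..N}"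
  shows "wins (x(i := b)) = wins x + real b - real (x i)"
proof -
  have "wins y = real (y i) + (\<Sum>j\<in>{1..N} - {i}. real (y j))" for y
    unfolding wins_def by (rule sum.remove) (use assms in auto)
  note this[of x] this[of "x(i := b)"]
  moreover have "(\<Sum>j\<in>{1..N} - {i}. real ((x(i := b)) j)) = (\<Sum>j\<in>{1..N} - {i}. real (x j))"
    by (intro sum.cong) auto
  ultimately show ?thesis by simp
qed

text \<open>A turn of player \<open>i\<close> changes the number of winners on average by
  \<open>heads a (nbrs N x i) - x i\<close>; the uniform choice of \<open>i\<close> then gives the
  drift. The weight \<open>c\<close> is evaluated at the phase after the turn.\<close>

lemma avg_wins:
  "avg (\<lambda>(x, a). c a * (wins x - real N / 2)) (x, a)
    = c (Suc a mod Suc r) * (wins x - real N / 2 + ((\<Sum>i=1..N. heads a (nbrs N x i)) - wins x) / real N)"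
proof -
  let ?c = "c (Suc a mod Suc r)"
  have "(\<Sum>b\<in>{0, 1}. coin (heads a (nbrs N x i)) b *
      (case (x(i := b), Suc a mod Suc r) of (x, a) \<Rightarrow> c a * (wins x - real N / 2)))
      = ?c * (wins x - real N / 2 + (heads a (nbrs N x i) - real (x i)))" if "i \<in> {1..N}" for i
    unfolding prod.case wins_update[OF that] by (simp add: coin_def field_simps)
  then have "avg (\<lambda>(x, a). c a * (wins x - real N / 2)) (x, a)
      = (\<Sum>i=1..N. ?c * (wins x - real N / 2 + (heads a (nbrs N x i) - real (x i)))) / real N"
    unfolding avg_eq by (intro arg_cong2[where f="(/)"] sum.cong refl)
  also have "\<dots> = ?c * ((\<Sum>i=1..N. wins x - real N / 2 + (heads a (nbrs N x i) - real (x i))) / real N)"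
    by (simp only: sum_distrib_left[symmetric] times_divide_eq_right)
  also have "(\<Sum>i=1..N. wins x - real N / 2 + (heads a (nbrs N x i) - real (x i)))
      = real N * (wins x - real N / 2) + ((\<Sum>i=1..N. heads a (nbrs N x i)) - wins x)"
    by (simp only: sum.distrib sum_subtractf wins_def) (simp add: algebra_simps)
  also have "\<dots> / real N = wins x - real N / 2 + ((\<Sum>i=1..N. heads a (nbrs N x i)) - wins x) / real N"
    using N by (simp only: add_divide_distrib) simp
  finally show ?thesis .
qed

lemma sum_heads_fair: "a < r \<Longrightarrow> (\<Sum>i=1..N. heads a (nbrs N x i)) = real N / 2"
  by (simp add: heads_def)

lemma sum_heads_B:
  "x \<in> statuses N \<Longrightarrow> (\<Sum>i=1..N. heads r (nbrs N x i)) = real N - wins x + (p 1 - 1/2) * discord x"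
  unfolding heads_def by (simp only: less_irrefl if_False sum_p_nbrs)

lemma reward_eq: "reward (x, a) = (2 * (\<Sum>i=1..N. heads a (nbrs N x i)) - real N) / real N"
  unfolding reward_def prod.case by (simp only: sum_subtractf sum_distrib_left[symmetric]) simp

lemma reward_fair: "a < r \<Longrightarrow> reward (x, a) = 0"
  by (simp only: reward_eq sum_heads_fair) simp

text \<open>
  The centred number of winners contracts by the factor \<open>1 - 1/N\<close> in a fair turn and by \<open>1 - 2/N\<close>,
  up to a multiple of \<open>discord\<close>, in a turn of game B. The weights \<open>weight a\<close> solve the resulting
  recursion, so that the corrected reward is a positive multiple of \<open>discord\<close>.
\<close>

definition weight_r :: real where
  "weight_r = - (2 / real N) / (1 - (1 - 1 / real N) ^ r * (1 - 2 / real N))"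

definition weight :: "nat \<Rightarrow> real" where
  "weight a = (1 - 1 / real N) ^ (r - a) * weight_r"

definition potential :: "status \<times> nat \<Rightarrow> real" where
  "potential = (\<lambda>(x, a). weight a * (wins x - real N / 2))"

lemma weight_denominator_pos: "1 - (1 - 1 / real N) ^ r * (1 - 2 / real N) > 0"
proof -
  have "(1 - 1 / real N) ^ r * (1 - 2 / real N) \<le> 1 * (1 - 2 / real N)"
    using N by (intro mult_right_mono power_le_one) (auto simp: field_simps)
  also have "\<dots> < 1" using N by simp
  finally show ?thesis by (rule diff_gt_0_iff_gt[THEN iffD2])
qed

text \<open>The condition that closes the cycle from phase \<open>r\<close> back to phase 0: it
  cancels the centred number of winners in the reward of game B. The value of
  \<open>weight_r\<close> is obtained by solving it.\<close>

lemma weight_B: "weight 0 * (1 - 2 / real N) - weight r = 2 / real N"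
proof -
  have "weight 0 * (1 - 2 / real N) - weight r
      = - weight_r * (1 - (1 - 1 / real N) ^ r * (1 - 2 / real N))"
    by (simp add: weight_def algebra_simps)
  also have "\<dots> = 2 / real N"
  proof -
    have "- (- e / d) * d = e" if "d > 0" for d e :: real using that by simp
    from this[OF weight_denominator_pos] show ?thesis unfolding weight_r_def .
  qed
  finally show ?thesis .
qed

text \<open>This makes the factor in front of \<open>discord\<close> positive. After clearing the
  denominator it amounts to \<open>?l ^ Suc r < 1\<close>.\<close>

lemma weight_0_bound: "2 + weight 0 > 0"
proof -
  let ?l = "1 - 1 / real N"
  let ?d = "1 - ?l ^ r * (1 - 2 / real N)"
  have "?l ^ Suc r < 1" using N by (intro power_Suc_less_one) (auto simp: field_simps)
  then have "?l ^ r * (2 / real N) < 2 * ?d" by (simp add: algebra_simps)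
  then have "?l ^ r * (2 / real N) / ?d < 2"
    using weight_denominator_pos by (simp only: pos_divide_less_eq)
  then show ?thesis by (simp add: weight_def weight_r_def)
qed

text \<open>The reward is zero, and the passage to the next weight exactly offsets the contraction
  of the centred number of winners.\<close>

lemma corrected_reward_fair:
  assumes "a < r"
  shows "reward (x, a) + avg potential (x, a) - potential (x, a) = 0"
proof -
  have "r - a = Suc (r - Suc a)" "Suc a mod Suc r = Suc a" using assms by auto
  then have w: "weight a = (1 - 1 / real N) * weight (Suc a mod Suc r)"
    unfolding weight_def by simp
  have "avg potential (x, a) = weight (Suc a mod Suc r) *
      (wins x - real N / 2 + (real N / 2 - wins x) / real N)"
    unfolding potential_def avg_wins sum_heads_fair[OF assms] ..
  also have "\<dots> = potential (x, a)"
    unfolding potential_def prod.case w by (simp add: diff_divide_distrib algebra_simps)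
  finally show ?thesis using reward_fair[OF assms] by simp
qed

text \<open>The terms in the centred number of winners cancel by \<open>weight_B\<close>. Discord
  enters with factor 2 through the payoff and with factor \<open>weight 0\<close> through the
  potential after the turn.\<close>

lemma corrected_reward_B:
  assumes x: "x \<in> statuses N"
  shows "reward (x, r) + avg potential (x, r) - potential (x, r)
    = (2 + weight 0) * ((p 1 - 1/2) * discord x / real N)"
proof -
  define h u where "h = wins x - real N / 2" and "u = (p 1 - 1/2) * discord x / real N"
  have Nu: "(p 1 - 1/2) * discord x = real N * u" using N by (simp add: u_def)
  have "reward (x, r) = (2 * (real N - wins x + real N * u) - real N) / real N"
    unfolding reward_eq sum_heads_B[OF x] Nu ..
  also have "\<dots> = 2 * u - h * (2 / real N)"
    using N by (simp add: h_def field_simps)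
  finally have rew: "reward (x, r) = 2 * u - h * (2 / real N)" .
  have "avg potential (x, r) = weight 0 * (h + (real N - wins x + real N * u - wins x) / real N)"
    unfolding potential_def avg_wins sum_heads_B[OF x] Nu h_def by simp
  also have "(real N - wins x + real N * u - wins x) / real N = u - h * (2 / real N)"
    using N by (simp add: h_def field_simps)
  finally have "reward (x, r) + avg potential (x, r) - potential (x, r)
      = (2 + weight 0) * u + h * (weight 0 * (1 - 2 / real N) - weight r - 2 / real N)"
    unfolding rew potential_def prod.case h_def[symmetric] by (simp add: algebra_simps)
  then show ?thesis unfolding weight_B u_def by simp
qed

section \<open>Sign of the mean profit\<close>

theorem mean_profit_pos:
  assumes r: "r \<ge> 1 \<or> odd N"
  shows "mean_profit N kernel > 0"
proof -
  let ?Z = "statuses N \<times> {..r}"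
  have d: "(alternating N 0, 0) \<in> ?Z" by (simp add: alternating_status)
  have "\<exists>G \<mu>. \<forall>z\<in>?Z. G z + \<mu> = reward z + avg G z"
    by (rule poisson_solvable[OF _ d]) (rule absorbing_contains_alternating_0[OF _ r])
  then obtain G \<mu> where G: "\<forall>z\<in>?Z. G z + \<mu> = reward z + avg G z" by (elim exE)
  \<comment> \<open>Subtracting \<open>potential\<close> from \<open>G\<close> keeps
    \<open>\<mu>\<close> and replaces the source \<open>reward\<close>, which may be negative, by
    the nonnegative \<open>f\<close>.\<close>
  define f where "f z = reward z + avg potential z - potential z" for z
  have f_B: "f (x, r) = (2 + weight 0) * ((p 1 - 1/2) * discord x / real N)" if "x \<in> statuses N" for x
    unfolding f_def by (rule corrected_reward_B[OF that])
  have "\<mu> > 0"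
  proof (rule poisson_pos[of "\<lambda>z. G z - potential z" \<mu> f])
    show "?Z \<noteq> {}" using d by blast
    fix z assume z: "z \<in> ?Z"
    then obtain x a where xa: "z = (x, a)" "x \<in> statuses N" "a \<le> r" by auto
    show "G z - potential z + \<mu> = f z + avg (\<lambda>z. G z - potential z) z"
      using bspec[OF G z] unfolding f_def avg_diff by linarith
    show "0 \<le> f z"
    proof (cases "a = r")
      case True
      then show ?thesis
        unfolding xa(1) True f_B[OF xa(2)] using weight_0_bound p1 discord_nonneg[of x] by simp
    next
      case False
      then have "a < r" using xa(3) by simp
      then show ?thesis unfolding xa(1) f_def by (simp only: corrected_reward_fair)
    qed
  next
    fix C assume C: "absorbing C"
    from absorbing_discord[OF C r] obtain x where x: "(x, r) \<in> C" "discord x > 0" by auto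
    have "f (x, r) > 0"
      unfolding f_B[OF absorbing_status(1)[OF C x(1)]] using weight_0_bound p1 x(2) N by simp
    with x(1) show "\<exists>z\<in>C. f z \<noteq> 0" by (intro bexI[of _ "(x, r)"]) simp_all
  qed
  moreover have "mean_profit N kernel = \<mu>"
    by (rule mean_profit_eq[of G]) (rule bspec[OF G])
  ultimately show ?thesis by simp
qed

text \<open>Evenness makes the alternation persist between players \<open>N\<close> and 1.\<close>

lemma alternating_nbrs:
  assumes "even N" and b: "b \<in> {0, 1}" and i: "i \<in> {1..N}"
  shows "alternating N b (left_of N i) = 1 - alternating N b i"
    and "alternating N b (right_of N i) = 1 - alternating N b i"
  using assms N by (auto simp: alternating_def left_of_def right_of_def)

text \<open>Shifting the circle by one place complements the vector, so winners and losers are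
  equally many.\<close>

lemma wins_alternating:
  assumes "even N" and b: "b \<in> {0, 1}"
  shows "wins (alternating N b) = real N / 2"
proof -
  have "wins (alternating N b) = (\<Sum>i=1..N. real (alternating N b (left_of N i)))"
    unfolding wins_def using N by (intro sum_left_of[symmetric]) simp
  also have "\<dots> = (\<Sum>i=1..N. 1 - real (alternating N b i))"
  proof (intro sum.cong refl)
    fix i assume i: "i \<in> {1..N}"
    then show "real (alternating N b (left_of N i)) = 1 - real (alternating N b i)"
      unfolding alternating_nbrs(1)[OF assms i] using b by (auto simp: alternating_def)
  qed
  also have "\<dots> = real N - wins (alternating N b)"
    unfolding wins_def by (simp only: sum_subtractf) simp
  finally show ?thesis by simp
qed

text \<open>Both alternating states are absorbing, so no single state lies in every absorbing set
  and \<open>poisson_solvable\<close> does not apply. Instead the Dirichlet problem with value 0 at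
  both is solved, and the solution satisfies the Poisson equation with \<open>\<mu> = 0\<close>
  there too.\<close>

theorem mean_profit_zero:
  assumes r: "r = 0" and even: "even N"
  shows "mean_profit N kernel = 0"
proof -
  let ?Z = "statuses N \<times> {..r}"
  define D where "D = {(alternating N 0, 0::nat), (alternating N 1, 0)}"
  have meets: "C \<inter> D \<noteq> {}" if "absorbing C" for C
    using absorbing_contains_alternating[OF that] unfolding D_def by auto
  have "\<exists>G. (\<forall>z\<in>?Z \<inter> D. G z = 0) \<and> (\<forall>z\<in>?Z - D. G z = reward z + avg G z)"
    by (rule dirichlet_solvable) (rule meets)
  then obtain G where G0: "\<forall>z\<in>?Z \<inter> D. G z = 0" and G: "\<forall>z\<in>?Z - D. G z = reward z + avg G z"
    by (elim exE conjE)
  have DZ: "D \<subseteq> ?Z" unfolding D_def by (auto simp: alternating_status)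
  have onD: "G z = reward z + avg G z" if z: "z \<in> D" for z
  proof -
    obtain b where b: "b \<in> {0, 1}" "z = (alternating N b, r)" using z r unfolding D_def by auto
    let ?x = "alternating N b"
    have x: "?x \<in> statuses N" using alternating_status[OF b(1)] .
    have "discord ?x = 0"
      unfolding discord_def by (intro sum.neutral ballI) (simp add: alternating_nbrs[OF even b(1)])
    then have "reward z = 0"
      unfolding b(2) reward_eq sum_heads_B[OF x] wins_alternating[OF even b(1)] by simp
    moreover have "K z (i, c) * G (step z (i, c)) = 0" if i: "i \<in> {1..N}" and c: "c \<in> {0, 1}" for i c
    proof (cases "c = ?x i")
      case True
      then have "step z (i, c) = z" unfolding step_def b(2) prod.case using r by simp
      then show ?thesis using G0 z DZ by auto
    next
      case False
      \<comment> \<open>A loser has two winning neighbours and a winner two losing ones, so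
        \<open>p 3 = 0\<close> or \<open>p 0 = 1\<close> reproduces the current status with
        certainty.\<close>
      have "p (nbrs N ?x i) = real (?x i)"
        using p0 p3 statusD[OF x i] unfolding nbrs_def alternating_nbrs[OF even b(1) i] by auto
      then have "K z (i, c) = 0"
        unfolding K_def heads_def b(2) prod.case using False c statusD[OF x i] by (auto simp: coin_def)
      then show ?thesis by simp
    qed
    then have "avg G z = 0" unfolding avg_def by (intro sum.neutral) auto
    moreover have "G z = 0" using G0 z DZ by blast
    ultimately show ?thesis by simp
  qed
  show ?thesis
  proof (rule mean_profit_eq)
    fix z assume "z \<in> ?Z"
    then show "G z + 0 = reward z + avg G z"
      using G onD by (cases "z \<in> D") auto
  qed
qed

end

theorem theorem6:
  fixes p :: "nat \<Rightarrow> real"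
  assumes "p 0 = 1" and "p 1 = p 2" and "p 1 \<in> {1/2<..<1}" and "p 3 = 0"
  shows "(\<forall>N\<ge>4. even N \<longrightarrow> mu_B N p = 0) \<and>
         (\<forall>N\<ge>3. odd N \<longrightarrow> mu_B N p > 0) \<and>
         (\<forall>N\<ge>3. \<forall>r\<ge>1. mu_pattern N p r 1 > 0) \<and>
         (\<forall>N\<ge>3. \<forall>r\<ge>1. parrondo_effect N p r 1 \<longleftrightarrow> even N)"
proof -
  have game_N: "pattern_game N p" if "N \<ge> 3" for N
    using assms that by unfold_locales auto
  \<comment> \<open>For \<open>r = 0\<close> the phase is always 0, which is not below
    \<open>r\<close>, so every turn is game B.\<close>
  have kernel_B: "pattern_game.kernel N 0 p = (\<lambda>_. game_B N p)" if "N \<ge> 3" for N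
  proof -
    interpret pattern_game N 0 p by (rule game_N[OF that])
    show ?thesis unfolding kernel_def heads_def by (simp add: fun_eq_iff)
  qed
  have kernel_pattern: "pattern_game.kernel N r p = (\<lambda>n. if n mod (r + 1) < r then game_A N else game_B N p)"
    if "N \<ge> 3" for N r
  proof -
    interpret pattern_game N r p by (rule game_N[OF that])
    show ?thesis unfolding kernel_def heads_def game_A_def by (rule ext) simp
  qed
  have zero: "mu_B N p = 0" if "N \<ge> 3" "even N" for N
    using pattern_game.mean_profit_zero[OF game_N[OF that(1)] refl that(2)]
    unfolding mu_B_def kernel_B[OF that(1)] .
  have pos: "mu_B N p > 0" if "N \<ge> 3" "odd N" for N
    using pattern_game.mean_profit_pos[OF game_N[OF that(1)], of 0] that(2)
    unfolding mu_B_def kernel_B[OF that(1)] by simp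
  have pat: "mu_pattern N p r 1 > 0" if "N \<ge> 3" "r \<ge> 1" for N r
    using pattern_game.mean_profit_pos[OF game_N[OF that(1)], of r] that(2)
    unfolding mu_pattern_def kernel_pattern[OF that(1)] by simp
  have "parrondo_effect N p r 1 \<longleftrightarrow> even N" if "N \<ge> 3" "r \<ge> 1" for N r
    using zero[OF that(1)] pos[OF that(1)] pat[OF that] unfolding parrondo_effect_def
    by (cases "even N") simp_all
  then show ?thesis using zero pos pat by simp
qed

end
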